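(* Let $h\ge 1$ be an integer and let $Q=\prod P$ be the product of all monic irreducible $P\in\mathbb F_q[T]$ with $|P|\le q^{2h}$. Then for every $\varepsilon>0$, \[m_5(Q;h)\ll_{\varepsilon} |Q|\,q^{(2+\varepsilon)h}.\]
   Context: $\mathbb F_q$ is a finite field with $q$ elements (fixed). For nonzero $F\in\mathbb F_q[T]$ set $|F|=q^{\deg F}$, and $|0|=0$. For monic $Q$, $\phi(Q)$ is the number of polynomials $A$ with $\deg A<\deg Q$ and $\gcd(A,Q)=1$. For $F\in\mathbb F_q[T]$ let $I(F,h)=\{G\in\mathbb F_q[T]:|F-G|<q^h\}$, and \[m_5(Q;h)=\sum_{F \bmod Q}\Big(\#\{G\in I(F,h):\gcd(G,Q)=1\}-\frac{q^h\phi(Q)}{|Q|}\Big)^5,\] where $F$ ranges over polynomials with $\deg F<\deg Q$. The implied constant depends only on $\varepsilon$ and $q$. *)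

theory Defs
  imports Complex_Main "HOL-Computational_Algebra.Polynomial" "HOL-Library.Cardinality"
begin

text \<open>
  The field with \<open>q\<close> elements is a type \<open>'a\<close> of sort \<open>{field, finite}\<close>, with \<open>q = CARD('a)\<close>.
\<close>

definition pnorm :: "'a::{field, finite} poly \<Rightarrow> nat" where
  "pnorm F = (if F = 0 then 0 else CARD('a) ^ degree F)"

text \<open>
  The library sets \<open>degree 0 = 0\<close>. The condition \<open>deg F < deg Q\<close> is meant with
  \<open>deg 0 < deg Q\<close> for every nonzero \<open>Q\<close>, including \<open>Q = 1\<close>, so 0 is admitted explicitly.
\<close>

definition residue_polys :: "'a::{field, finite} poly \<Rightarrow> 'a poly set" where
  "residue_polys Q = {F. F = 0 \<or> degree F < degree Q}"

definition poly_phi :: "'a::{field, finite} poly \<Rightarrow> nat" where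
  "poly_phi Q = card {A \<in> residue_polys Q. coprime A Q}"

definition short_interval :: "'a::{field, finite} poly \<Rightarrow> nat \<Rightarrow> 'a poly set" where
  "short_interval F h = {G. pnorm (F - G) < CARD('a) ^ h}"

definition m5 :: "'a::{field, finite} poly \<Rightarrow> nat \<Rightarrow> real" where
  "m5 Q h = (\<Sum>F\<in>residue_polys Q.
     (real (card {G \<in> short_interval F h. coprime G Q})
        - real (CARD('a) ^ h) * real (poly_phi Q) / real (pnorm Q)) ^ 5)"

definition small_irreducibles :: "nat \<Rightarrow> 'a::{field, finite} poly set" where
  "small_irreducibles h = {P. irreducible P \<and> lead_coeff P = 1 \<and> pnorm P \<le> CARD('a) ^ (2 * h)}"

definition small_primorial :: "nat \<Rightarrow> 'a::{field, finite} poly" where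
  "small_primorial h = \<Prod>(small_irreducibles h)"

text \<open>
  The index sets above are finite, so no cardinality, sum or product takes the library's
  default value for infinite sets.
\<close>

lemma card_field_gt_1: "CARD('a::{field, finite}) > 1"
proof -
  have "card {0, 1 :: 'a} \<le> CARD('a)"
    by (rule card_mono) auto
  thus ?thesis by simp
qed

lemma finite_degree_le: "finite {F :: 'a::{field, finite} poly. degree F \<le> n}"
proof (rule finite_subset)
  show "{F :: 'a poly. degree F \<le> n} \<subseteq> Poly ` {xs. set xs \<subseteq> UNIV \<and> length xs \<le> Suc n}"
  proof
    fix F :: "'a poly"
    assume "F \<in> {F. degree F \<le> n}"
    hence "length (coeffs F) \<le> Suc n"
      by (cases "F = 0") (auto simp: length_coeffs_degree)
    moreover have "F = Poly (coeffs F)" by simp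
    ultimately show "F \<in> Poly ` {xs. set xs \<subseteq> UNIV \<and> length xs \<le> Suc n}" by blast
  qed
  show "finite (Poly ` {xs :: 'a list. set xs \<subseteq> UNIV \<and> length xs \<le> Suc n})"
    by (intro finite_imageI finite_lists_length_le) auto
qed

lemma finite_pnorm_le: "finite {F :: 'a::{field, finite} poly. pnorm F \<le> CARD('a) ^ n}"
  by (rule finite_subset[OF _ finite_degree_le[of n]])
     (use card_field_gt_1[where 'a = 'a] in \<open>auto simp: pnorm_def split: if_splits\<close>)

lemma finite_residue_polys: "finite (residue_polys (Q :: 'a::{field, finite} poly))"
  by (rule finite_subset[OF _ finite_degree_le[of "degree Q"]]) (auto simp: residue_polys_def)

lemma finite_short_interval: "finite (short_interval (F :: 'a::{field, finite} poly) h)"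
proof (rule finite_subset)
  show "short_interval F h \<subseteq> (\<lambda>D. F - D) ` {D. pnorm D \<le> CARD('a) ^ h}"
  proof
    fix G assume "G \<in> short_interval F h"
    hence "F - G \<in> {D. pnorm D \<le> CARD('a) ^ h}" by (simp add: short_interval_def)
    moreover have "G = F - (F - G)" by simp
    ultimately show "G \<in> (\<lambda>D. F - D) ` {D. pnorm D \<le> CARD('a) ^ h}" by blast
  qed
  show "finite ((\<lambda>D. F - D) ` {D. pnorm D \<le> CARD('a) ^ h})"
    by (intro finite_imageI finite_pnorm_le)
qed

lemma finite_small_irreducibles: "finite (small_irreducibles h :: 'a::{field, finite} poly set)"
  by (rule finite_subset[OF _ finite_pnorm_le[of "2 * h"]]) (auto simp: small_irreducibles_def)

end

theory Submission
  imports Defs "HOL-Computational_Algebra.Polynomial_Factorial"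
begin

text \<open>
  Expanding the indicator of coprimality to \<open>Q\<close> in additive characters bounds \<open>m5 Q h\<close> by
  \<open>|Q| q^(5h)\<close> times the sum of \<open>1 / (|R_1| ... |R_5|)\<close> over all quintuples of nonzero fractions
  \<open>a_i / R_i\<close> in lowest terms with \<open>R_i\<close> dividing \<open>Q\<close>, \<open>|a_i / R_i| < q^(-h)\<close> and zero sum.

  For two fractions of sum \<open>\<beta>\<close>, let the overlap be the degree of \<open>gcd R_1 R_2\<close> plus the degree of the
  part of this gcd that cancels in the denominator of \<open>\<beta>\<close>. If \<open>D\<close> is that denominator, then
  \<open>|R_1 R_2| = |D| q^overlap\<close>, and there are essentially at most \<open>max 1 q^(overlap - h)\<close> pairs with
  given data. So the sum of \<open>q^(min overlap h) / |R_1 R_2|\<close> over the pairs of sum \<open>\<beta>\<close> is at most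
  \<open>1 / |D|\<close> up to a divisor function: a pair behaves like the single fraction \<open>\<beta>\<close>, with an additional
  gain of \<open>q^(min overlap h)\<close>.

  In a zero sum every prime divides at least two denominators, and all denominators have degree at
  least \<open>h\<close>. Averaging over all pairs shows that some pair out of three fractions has overlap at
  least \<open>h\<close>, and that among five fractions some two disjoint pairs have total overlap at least \<open>h\<close>;
  it suffices to average over the five rotations of one such choice. Hence the sum over triples is
  about \<open>q^(-2h)\<close>, and collapsing two pairs reduces the sum over quintuples to \<open>q^(-h)\<close> times the
  sum over triples. The divisor functions cost \<open>q^(\<epsilon> h)\<close>.
\<close>

section \<open>Polynomials of bounded degree\<close>

definition lowdeg :: "nat \<Rightarrow> 'a::{field, finite} poly set" where
  "lowdeg m = {F. F = 0 \<or> degree F < m}"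

lemma lowdeg_iff_coeff: "F \<in> lowdeg m \<longleftrightarrow> (\<forall>k\<ge>m. coeff F k = 0)"
proof
  assume "\<forall>k\<ge>m. coeff F k = 0"
  thus "F \<in> lowdeg m"
    unfolding lowdeg_def using leading_coeff_0_iff[of F] not_le_imp_less by blast
qed (auto simp: lowdeg_def coeff_eq_0)

lemma zero_in_lowdeg [simp]: "0 \<in> lowdeg m"
  by (simp add: lowdeg_def)

lemma lowdeg_add: "F \<in> lowdeg m \<Longrightarrow> G \<in> lowdeg m \<Longrightarrow> F + G \<in> lowdeg m"
  by (simp add: lowdeg_iff_coeff)

lemma lowdeg_diff: "F \<in> lowdeg m \<Longrightarrow> G \<in> lowdeg m \<Longrightarrow> F - G \<in> lowdeg m"
  by (simp add: lowdeg_iff_coeff)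

lemma lowdeg_uminus_iff [simp]: "- F \<in> lowdeg m \<longleftrightarrow> F \<in> lowdeg m"
  by (simp add: lowdeg_iff_coeff)

lemma lowdeg_mono: "m \<le> k \<Longrightarrow> F \<in> lowdeg m \<Longrightarrow> F \<in> lowdeg k"
  by (auto simp: lowdeg_def)

lemma lowdeg_mult: "F \<in> lowdeg m \<Longrightarrow> F * G \<in> lowdeg (m + degree G)"
  using degree_mult_le[of F G] by (fastforce simp: lowdeg_def)

lemma finite_lowdeg [simp]: "finite (lowdeg m)"
  by (rule finite_subset[OF _ finite_degree_le[of m]]) (auto simp: lowdeg_def)

lemma card_lowdeg: "card (lowdeg m :: 'a::{field, finite} poly set) = CARD('a) ^ m"
proof (induction m)
  case 0
  have "lowdeg 0 = {0 :: 'a poly}" by (auto simp: lowdeg_def)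
  thus ?case by simp
next
  case (Suc m)
  have "lowdeg (Suc m) = (\<lambda>(c, F). pCons c F) ` (UNIV \<times> (lowdeg m :: 'a poly set))"
  proof (intro equalityI subsetI)
    fix F :: "'a poly" assume F: "F \<in> lowdeg (Suc m)"
    obtain c G where "F = pCons c G" by (cases F)
    moreover from this have "G \<in> lowdeg m"
      using F by (auto simp: lowdeg_iff_coeff coeff_pCons split: nat.splits)
    ultimately show "F \<in> (\<lambda>(c, F). pCons c F) ` (UNIV \<times> lowdeg m)" by auto
  qed (auto simp: lowdeg_iff_coeff coeff_pCons split: nat.splits)
  moreover have "inj_on (\<lambda>(c, F). pCons c F) (UNIV \<times> (lowdeg m :: 'a poly set))"
    by (auto simp: inj_on_def)
  ultimately show ?case
    by (simp add: card_image card_cartesian_product Suc)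
qed

text \<open>Division by \<open>D\<close> keeps the values distinct and lowers degrees by
  \<open>degree D\<close>. The truncated exponent is right also for \<open>k \<le> degree D\<close>,
  where 0 is the only admissible multiple.\<close>

lemma card_le_of_inj_multiples:
  fixes f :: "'b \<Rightarrow> 'a::{field, finite} poly"
  assumes "D \<noteq> 0" "inj_on f Z"
    and "\<And>z. z \<in> Z \<Longrightarrow> D dvd f z \<and> f z \<in> lowdeg k"
  shows "card Z \<le> CARD('a) ^ (k - degree D)"
proof -
  have "inj_on (\<lambda>z. f z div D) Z"
  proof (rule inj_onI)
    fix x y assume xy: "x \<in> Z" "y \<in> Z" "f x div D = f y div D"
    hence "f x = f y" using assms(3) by (metis dvd_div_mult_self)
    thus "x = y" using assms(2) xy by (auto dest: inj_onD)
  qed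
  moreover have "(\<lambda>z. f z div D) ` Z \<subseteq> lowdeg (k - degree D)"
  proof safe
    fix z assume z: "z \<in> Z"
    from assms(3)[OF z] obtain t where t: "f z = D * t" by blast
    show "f z div D \<in> lowdeg (k - degree D)"
      using assms(1) assms(3)[OF z] unfolding t
      by (cases "t = 0") (auto simp: lowdeg_def degree_mult_eq)
  qed
  ultimately have "card Z \<le> card (lowdeg (k - degree D) :: 'a poly set)"
    by (metis card_inj_on_le finite_lowdeg)
  thus ?thesis by (simp add: card_lowdeg)
qed

section \<open>Divisors of a product of distinct monic primes\<close>

definition dg :: "'a::{field, finite} poly set \<Rightarrow> nat" where
  "dg T = (\<Sum>P\<in>T. degree P)"

text \<open>Subsets of \<open>S\<close> encode the monic divisors of the squarefree polynomial
  \<open>\<Prod>S\<close>: union, intersection and \<open>dg\<close> become lcm, gcd and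
  degree.\<close>

locale monic_primes =
  fixes S :: "'a::{field, finite} poly set"
  assumes fin: "finite S"
    and irred: "P \<in> S \<Longrightarrow> irreducible P"
    and monic: "P \<in> S \<Longrightarrow> lead_coeff P = 1"
begin

lemma prime_elem_S: "P \<in> S \<Longrightarrow> prime_elem P"
  using irred by (simp add: field_poly_irreducible_imp_prime)

lemma nonzero_S: "P \<in> S \<Longrightarrow> P \<noteq> 0"
  using irred by (metis not_irreducible_zero)

lemma degree_pos_S: "P \<in> S \<Longrightarrow> degree P > 0"
  using irred[of P] is_unit_iff_degree[of P] by (auto simp: irreducible_def)

lemma finite_sub: "T \<subseteq> S \<Longrightarrow> finite T"
  using fin finite_subset by blast

lemma dvd_S_imp_eq:
  assumes "P \<in> S" "R \<in> S" "P dvd R"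
  shows "P = R"
proof -
  obtain U where U: "R = P * U" using assms(3) by blast
  moreover have "\<not> P dvd 1" using irred[OF assms(1)] by (simp add: irreducible_def)
  ultimately have "U dvd 1" using irred[OF assms(2)] by (meson irreducibleD)
  then obtain c where "U = [:c:]" by (auto simp: is_unit_poly_iff)
  moreover have "lead_coeff U = 1"
    using monic[OF assms(1)] monic[OF assms(2)] unfolding U by (simp add: lead_coeff_mult)
  ultimately show ?thesis using U by (simp add: one_pCons)
qed

lemma dvd_prod_S_iff:
  assumes "P \<in> S" "T \<subseteq> S"
  shows "P dvd \<Prod>T \<longleftrightarrow> P \<in> T"
proof
  assume "P dvd \<Prod>T"
  hence "\<exists>R\<in>T. P dvd R"
    using finite_sub[OF assms(2)]
  proof (induction T rule: infinite_finite_induct)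
    case empty
    thus ?case using irred[OF assms(1)] by (simp add: irreducible_def)
  next
    case (insert R T)
    have "P dvd R * \<Prod>T" using insert by simp
    hence "P dvd R \<or> P dvd \<Prod>T"
      using prime_elem_S[OF assms(1)] prime_elem_dvd_multD by blast
    thus ?case using insert by blast
  qed auto
  thus "P \<in> T" using dvd_S_imp_eq assms by blast
qed (use assms finite_sub in auto)

lemma prod_dvdI:
  assumes "T \<subseteq> S" "\<And>P. P \<in> T \<Longrightarrow> P dvd A"
  shows "\<Prod>T dvd A"
  using finite_sub[OF assms(1)] assms
proof (induction T rule: finite_induct)
  case (insert P T)
  then obtain K where K: "A = \<Prod>T * K" by blast
  have "P dvd \<Prod>T * K" "\<not> P dvd \<Prod>T" "prime_elem P"
    using insert dvd_prod_S_iff[of P T] prime_elem_S K by auto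
  hence "P dvd K" using prime_elem_dvd_multD by blast
  thus ?case using insert K by (simp add: mult.commute mult_dvd_mono)
qed auto

lemma prod_dvd_iff: "T \<subseteq> S \<Longrightarrow> \<Prod>T dvd A \<longleftrightarrow> (\<forall>P\<in>T. P dvd A)"
  using prod_dvdI finite_sub by (metis dvd_prodI dvd_trans)

lemma prod_nonzero: "T \<subseteq> S \<Longrightarrow> \<Prod>T \<noteq> 0"
  using finite_sub nonzero_S by (metis prod_zero_iff subsetD)

lemma degree_prod_S: "T \<subseteq> S \<Longrightarrow> degree (\<Prod>T) = dg T"
  unfolding dg_def using nonzero_S by (intro degree_prod_eq_sum_degree) auto

lemma monic_prod_S: "T \<subseteq> S \<Longrightarrow> lead_coeff (\<Prod>T) = 1"
  using monic by (auto simp: lead_coeff_prod intro!: prod.neutral)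

lemma dg_Un: "T \<subseteq> S \<Longrightarrow> R \<subseteq> S \<Longrightarrow> T \<inter> R = {} \<Longrightarrow> dg (T \<union> R) = dg T + dg R"
  unfolding dg_def using finite_sub by (intro sum.union_disjoint) auto

lemma dg_Un3:
  assumes "T \<subseteq> S" "R \<subseteq> S" "V \<subseteq> S" "T \<inter> R = {}" "T \<inter> V = {}" "R \<inter> V = {}"
  shows "dg (T \<union> R \<union> V) = dg T + dg R + dg V"
  using assms by (simp add: dg_Un Int_Un_distrib2)

lemma dg_Diff: "T \<subseteq> S \<Longrightarrow> R \<subseteq> T \<Longrightarrow> dg T = dg (T - R) + dg R"
  using dg_Un[of "T - R" R]
  by (metis Diff_disjoint Diff_partition Int_commute Diff_subset subset_trans sup_commute)

text \<open>
  The fraction \<open>A / \<Prod>S\<close> is represented by its numerator \<open>A\<close>. Its denominator in lowest terms is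
  then \<open>\<Prod>(nondiv A)\<close>.
\<close>

definition nondiv :: "'a poly \<Rightarrow> 'a poly set" where
  "nondiv A = {P \<in> S. \<not> P dvd A}"

lemma nondiv_subset: "nondiv A \<subseteq> S"
  by (auto simp: nondiv_def)

lemma nondiv_uminus [simp]: "nondiv (- A) = nondiv A"
  by (simp add: nondiv_def)

lemma nondiv_zero [simp]: "nondiv 0 = {}"
  by (simp add: nondiv_def)

lemma finite_nondiv [simp]: "finite (nondiv A)"
  using nondiv_subset finite_sub by blast

end

subsection \<open>Sums over two fractions\<close>

locale short_sums = monic_primes S for S :: "'a::{field, finite} poly set" +
  fixes h :: nat and q :: real
  assumes q_eq: "q = real CARD('a)"
begin

lemma q_gt_1: "q > 1"
  using card_field_gt_1[where 'a = 'a] by (simp add: q_eq)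

lemma q_pos [simp]: "q > 0"
  using q_gt_1 by linarith

lemma q_nonneg [simp]: "q \<ge> 0"
  using q_pos by linarith

lemma q_nonzero [simp]: "q \<noteq> 0"
  using q_pos by linarith

text \<open>Numerators of the nonzero fractions \<open>A / \<Prod>S\<close> of absolute value below
  \<open>q^(-h)\<close>.\<close>

definition box :: "'a poly set" where
  "box = lowdeg (dg S - h) - {0}"

text \<open>For a fraction whose reduced denominator \<open>R\<close> has \<open>k\<close> prime
  factors this is \<open>c^k / |R|\<close>. The parameter \<open>c\<close> absorbs the divisor
  functions that arise when pairs are collapsed.\<close>

definition wt :: "real \<Rightarrow> 'a poly \<Rightarrow> real" where
  "wt c A = c ^ card (nondiv A) / q ^ dg (nondiv A)"

definition common :: "'a poly \<Rightarrow> 'a poly \<Rightarrow> 'a poly set" where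
  "common A B = nondiv A \<inter> nondiv B"

definition cancel :: "'a poly \<Rightarrow> 'a poly \<Rightarrow> 'a poly set" where
  "cancel A B = common A B - nondiv (A + B)"

definition overlap :: "'a poly \<Rightarrow> 'a poly \<Rightarrow> nat" where
  "overlap A B = dg (common A B) + dg (cancel A B)"

lemma finite_box [simp]: "finite box"
  by (simp add: box_def)

lemma cancel_subset: "cancel A B \<subseteq> S"
  using nondiv_subset by (auto simp: cancel_def common_def)

lemma finite_cancel [simp]: "finite (cancel A B)"
  using cancel_subset finite_sub by blast

lemma nondiv_diff_subset: "nondiv A - nondiv B \<subseteq> nondiv (A + B)"
  by (auto simp: nondiv_def dvd_add_left_iff)

lemma nondiv_diff_subset': "nondiv B - nondiv A \<subseteq> nondiv (A + B)"
  by (auto simp: nondiv_def dvd_add_right_iff)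

lemma nondiv_add_subset: "nondiv (A + B) \<subseteq> nondiv A \<union> nondiv B"
  by (auto simp: nondiv_def)

text \<open>The primes of the two denominators fall into four disjoint blocks: those only in the
  first, those only in the second, shared ones that survive in the denominator of the sum, and
  shared ones that cancel.\<close>

lemma nondiv_decomp:
  fixes A B :: "'a poly"
  defines "X \<equiv> nondiv A - nondiv B" and "Y \<equiv> nondiv B - nondiv A" and "U \<equiv> nondiv (A + B)"
  shows "nondiv A = X \<union> (U - X - Y) \<union> cancel A B"
    and "nondiv B = Y \<union> (U - X - Y) \<union> cancel A B"
    and "common A B = (U - X - Y) \<union> cancel A B"
    and "U = X \<union> Y \<union> (U - X - Y)"
  using nondiv_diff_subset[of A B] nondiv_diff_subset'[of B A] nondiv_add_subset[of A B]
  unfolding X_def Y_def U_def cancel_def common_def by auto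

text \<open>\<open>R_1 R_2\<close> is gcd times lcm, and the lcm is the denominator of the sum times
  the cancelled part. Hence the overlap counts cancelled primes twice.\<close>

lemma dg_decomp:
  fixes A B :: "'a poly"
  defines "X \<equiv> nondiv A - nondiv B" and "Y \<equiv> nondiv B - nondiv A" and "U \<equiv> nondiv (A + B)"
  shows "dg (common A B) = dg (U - X - Y) + dg (cancel A B)"
    and "dg (nondiv A) + dg (nondiv B) = dg U + overlap A B"
proof -
  define g where "g = cancel A B"
  define G where "G = U - X - Y"
  note dec = nondiv_decomp[where A = A and B = B, folded X_def Y_def U_def, folded g_def, folded G_def]
  have sub: "X \<subseteq> S" "Y \<subseteq> S" "G \<subseteq> S" "g \<subseteq> S"
    unfolding X_def Y_def G_def U_def g_def using nondiv_subset cancel_subset by blast+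
  have disj: "X \<inter> Y = {}" "X \<inter> G = {}" "Y \<inter> G = {}" "g \<inter> G = {}" "g \<inter> X = {}" "g \<inter> Y = {}"
    unfolding X_def Y_def G_def U_def g_def cancel_def common_def by auto
  have 1: "dg (nondiv A) = dg X + dg G + dg g"
    using dg_Un3[of X G g] sub disj dec(1) by (simp add: Int_commute)
  have 2: "dg (nondiv B) = dg Y + dg G + dg g"
    using dg_Un3[of Y G g] sub disj dec(2) by (simp add: Int_commute)
  have 3: "dg (common A B) = dg G + dg g"
    using dg_Un[of G g] sub disj dec(3) by (simp add: Int_commute)
  have 4: "dg U = dg X + dg Y + dg G"
    using dg_Un3[of X Y G] sub disj dec(4) by simp
  show "dg (common A B) = dg (U - X - Y) + dg (cancel A B)"
    using 3 by (simp add: G_def g_def)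
  show "dg (nondiv A) + dg (nondiv B) = dg U + overlap A B"
    using 1 2 3 4 by (simp add: overlap_def g_def)
qed

text \<open>Each denominator divides the denominator of the sum times the cancelled part.\<close>

lemma card_nondiv_add_le:
  "card (nondiv A) + card (nondiv B) \<le> 2 * card (nondiv (A + B)) + 2 * card (cancel A B)"
proof -
  have "card (nondiv A) \<le> card (nondiv (A + B) \<union> cancel A B)"
    using nondiv_diff_subset[of A B] by (intro card_mono) (auto simp: cancel_def common_def)
  moreover have "card (nondiv B) \<le> card (nondiv (A + B) \<union> cancel A B)"
    using nondiv_diff_subset'[of B A] by (intro card_mono) (auto simp: cancel_def common_def)
  ultimately show ?thesis
    using card_Un_le[of "nondiv (A + B)" "cancel A B"] by linarith
qed

lemma wt_nonneg: "c \<ge> 0 \<Longrightarrow> wt c A \<ge> 0"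
  by (simp add: wt_def)

lemma wt_uminus [simp]: "wt c (- A) = wt c A"
  by (simp add: wt_def)

lemma wt_mono: "0 \<le> c \<Longrightarrow> c \<le> d \<Longrightarrow> wt c A \<le> wt d A"
  by (simp add: wt_def divide_right_mono power_mono)

text \<open>
  If \<open>A\<close> and \<open>A'\<close> lie in the class, then \<open>(A - A') \<Prod>g(A) \<Prod>g(A')\<close> is divisible by every prime
  outside the fixed part of the common support, where \<open>g\<close> is the cancelled set. The product
  determines \<open>A\<close>: by coprimality of \<open>\<Prod>g(A')\<close> and \<open>A'\<close>, it determines \<open>\<Prod>g(A)\<close> modulo \<open>\<Prod>g(A')\<close>,
  and both are monic of the same degree.
\<close>

lemma card_class_degree_le:
  assumes Z: "Z \<subseteq> box"
    and X: "\<And>A. A \<in> Z \<Longrightarrow> nondiv A - nondiv (\<beta> - A) = X"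
    and Y: "\<And>A. A \<in> Z \<Longrightarrow> nondiv (\<beta> - A) - nondiv A = Y"
    and \<delta>: "\<And>A. A \<in> Z \<Longrightarrow> dg (cancel A (\<beta> - A)) = \<delta>"
  shows "card Z \<le> CARD('a) ^ (dg (nondiv \<beta> - X - Y) + 2 * \<delta> - h)"
proof (cases "Z = {}")
  case False
  then obtain A' where A': "A' \<in> Z" by blast
  define U where "U = nondiv \<beta>"
  define G where "G = U - X - Y"
  define gs where "gs A = cancel A (\<beta> - A)" for A
  define g where "g A = \<Prod>(gs A)" for A
  have gs: "gs A \<subseteq> S" for A by (simp add: gs_def cancel_subset)
  have g0: "g A \<noteq> 0" for A unfolding g_def using gs prod_nonzero by blast
  have gdeg: "degree (g A) = \<delta>" if "A \<in> Z" for A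
    using \<delta>[OF that] degree_prod_S[OF gs] by (simp add: g_def gs_def)
  have dvd_g: "P dvd g A" if "P \<in> gs A" for P A
    using that gs[of A] dvd_prod_S_iff[of P "gs A"] by (auto simp: g_def)
  have inX: "P dvd \<beta> - A" if "P \<in> X" "A \<in> Z" for P A
    using X[OF that(2)] that(1) by (auto simp: nondiv_def)
  have inY: "P dvd A" if "P \<in> Y" "A \<in> Z" for P A
    using Y[OF that(2)] that(1) by (auto simp: nondiv_def)
  have outU: "P dvd A \<or> P \<in> gs A" if "P \<in> S" "P \<notin> U" for P A
  proof -
    have "P dvd \<beta>" using that by (auto simp: U_def nondiv_def)
    hence "P dvd \<beta> - A \<longleftrightarrow> P dvd A" using dvd_diff_right_iff by blast
    thus ?thesis using \<open>P dvd \<beta>\<close> that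
      by (auto simp: gs_def cancel_def common_def nondiv_def)
  qed
  have XY: "X \<subseteq> S" "Y \<subseteq> S" "U \<subseteq> S" "X \<subseteq> U" "Y \<subseteq> U"
    using X[OF A'] Y[OF A'] nondiv_diff_subset[of A' "\<beta> - A'"] nondiv_diff_subset'[of "\<beta> - A'" A']
      nondiv_subset by (auto simp: U_def)
  have "G \<subseteq> S" using XY by (auto simp: G_def)
  define f where "f A = (A - A') * g A * g A'" for A
  have dvd: "\<Prod>(S - G) dvd f A" if A: "A \<in> Z" for A
  proof (rule prod_dvdI)
    fix P assume P: "P \<in> S - G"
    consider "P \<in> X" | "P \<in> Y" | "P \<notin> U" using P by (auto simp: G_def)
    thus "P dvd f A"
    proof cases
      case 1
      have "P dvd (\<beta> - A') - (\<beta> - A)" using dvd_diff[OF inX[OF 1 A'] inX[OF 1 A]] .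
      thus ?thesis by (simp add: f_def)
    next
      case 2
      thus ?thesis using inY A A' by (auto simp: f_def)
    next
      case 3
      hence "P dvd A - A' \<or> P dvd g A \<or> P dvd g A'"
        using outU[of P A] outU[of P A'] P dvd_g by auto
      thus ?thesis by (auto simp: f_def)
    qed
  qed auto
  have low: "f A \<in> lowdeg (dg S - h + 2 * \<delta>)" if A: "A \<in> Z" for A
  proof -
    have "A - A' \<in> lowdeg (dg S - h)"
      using A A' Z by (auto simp: box_def intro: lowdeg_diff)
    from lowdeg_mult[OF lowdeg_mult[OF this, of "g A"], of "g A'"] show ?thesis
      by (simp add: f_def gdeg A A' mult_2 add.assoc)
  qed
  have inj: "inj_on f Z"
  proof (rule inj_onI)
    fix A B assume AB: "A \<in> Z" "B \<in> Z" "f A = f B"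
    hence "(A - A') * g A = (B - A') * g B" by (simp add: f_def g0)
    hence eq: "A * g A - B * g B = A' * (g A - g B)" by (simp add: algebra_simps)
    have "g A' dvd g A - g B" unfolding g_def[of A']
    proof (rule prod_dvdI[OF gs])
      fix P assume P: "P \<in> gs A'"
      hence PS: "P \<in> S" "P \<notin> U" "\<not> P dvd A'"
        using gs by (auto simp: gs_def cancel_def common_def U_def nondiv_def)
      have "P dvd C * g C" for C using outU[OF PS(1,2), of C] dvd_g[of P C] by auto
      hence "P dvd A' * (g A - g B)" by (simp flip: eq)
      thus "P dvd g A - g B"
        using prime_elem_dvd_multD prime_elem_S PS by blast
    qed
    moreover have "g A - g B = 0 \<or> degree (g A - g B) < degree (g A')"
    proof -
      have "g A - g B \<in> lowdeg \<delta>" unfolding lowdeg_iff_coeff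
      proof safe
        fix k assume "\<delta> \<le> k"
        thus "coeff (g A - g B) k = 0"
          using monic_prod_S[OF gs, of A, folded g_def] monic_prod_S[OF gs, of B, folded g_def]
            gdeg[OF AB(1)] gdeg[OF AB(2)] by (cases "k = \<delta>") (simp_all add: coeff_eq_0)
      qed
      thus ?thesis using gdeg[OF A'] by (auto simp: lowdeg_def)
    qed
    ultimately have "g A = g B" by (metis dvd_imp_degree_le not_less eq_iff_diff_eq_0)
    thus "A = B" using \<open>(A - A') * g A = (B - A') * g B\<close> g0 by simp
  qed
  have "card Z \<le> CARD('a) ^ (dg S - h + 2 * \<delta> - degree (\<Prod>(S - G)))"
    using inj dvd low by (intro card_le_of_inj_multiples[of _ f] prod_nonzero) auto
  also have "dg S - h + 2 * \<delta> - degree (\<Prod>(S - G)) \<le> dg G + 2 * \<delta> - h"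
  proof -
    \<comment> \<open>\<open>box\<close> has an element here, so \<open>dg S - h\<close> is not
      truncated.\<close>
    have "dg S > h" using A' Z by (auto simp: box_def lowdeg_def)
    moreover have "dg S = dg (S - G) + dg G" using dg_Diff[of S G] \<open>G \<subseteq> S\<close> by simp
    ultimately show ?thesis by (simp add: degree_prod_S)
  qed
  hence "CARD('a) ^ (dg S - h + 2 * \<delta> - degree (\<Prod>(S - G))) \<le> CARD('a) ^ (dg G + 2 * \<delta> - h)"
    using card_field_gt_1[where 'a = 'a] by (intro power_increasing) auto
  finally show ?thesis by (simp add: G_def U_def)
qed auto

text \<open>Fixing the cancelled set itself fixes the common support, and \<open>A\<close> is
  determined modulo every prime outside it. So \<open>dg T\<close> enters the exponent only once, at
  the price of a later sum over all \<open>T\<close>.\<close>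

lemma card_class_cancel_le:
  assumes Z: "Z \<subseteq> box"
    and X: "\<And>A. A \<in> Z \<Longrightarrow> nondiv A - nondiv (\<beta> - A) = X"
    and Y: "\<And>A. A \<in> Z \<Longrightarrow> nondiv (\<beta> - A) - nondiv A = Y"
    and T: "\<And>A. A \<in> Z \<Longrightarrow> cancel A (\<beta> - A) = T"
  shows "card Z \<le> CARD('a) ^ (dg (nondiv \<beta> - X - Y) + dg T - h)"
proof (cases "Z = {}")
  case False
  then obtain A' where A': "A' \<in> Z" by blast
  define H where "H = common A' (\<beta> - A')"
  have H_eq: "H = (nondiv \<beta> - X - Y) \<union> T"
    using nondiv_decomp(3)[of A' "\<beta> - A'"] X[OF A'] Y[OF A'] T[OF A'] by (simp add: H_def)
  have H: "common A (\<beta> - A) = H" if "A \<in> Z" for A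
    using nondiv_decomp(3)[of A "\<beta> - A"] X[OF that] Y[OF that] T[OF that] H_eq by simp
  have HS: "H \<subseteq> S" using nondiv_subset by (auto simp: H_def common_def)
  have dgH: "dg H = dg (nondiv \<beta> - X - Y) + dg T"
    using dg_decomp(1)[of A' "\<beta> - A'"] X[OF A'] Y[OF A'] T[OF A'] by (simp add: H_def)
  have dvd: "\<Prod>(S - H) dvd A - A'" if A: "A \<in> Z" for A
  proof (rule prod_dvdI)
    fix P assume P: "P \<in> S - H"
    have split: "nondiv C = (nondiv C - nondiv D) \<union> common C D"
      "nondiv D = (nondiv D - nondiv C) \<union> common C D" for C D
      by (auto simp: common_def)
    have "nondiv C = X \<union> H" "nondiv (\<beta> - C) = Y \<union> H" if "C \<in> Z" for C
      using split(1)[of C "\<beta> - C"] split(2)[where C = C and D = "\<beta> - C"] X[OF that] Y[OF that] H[OF that]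
      by simp_all
    moreover have "X \<inter> Y = {}" using X[OF A'] Y[OF A'] by blast
    ultimately have "P dvd A \<and> P dvd A' \<or> P dvd \<beta> - A \<and> P dvd \<beta> - A'"
      using P A A' unfolding nondiv_def by blast
    moreover have "A - A' = (\<beta> - A') - (\<beta> - A)" by simp
    ultimately show "P dvd A - A'" by (metis dvd_diff)
  qed auto
  have low: "A - A' \<in> lowdeg (dg S - h)" if A: "A \<in> Z" for A
    using A A' Z by (auto simp: box_def intro: lowdeg_diff)
  have "card Z \<le> CARD('a) ^ (dg S - h - degree (\<Prod>(S - H)))"
    using dvd low by (intro card_le_of_inj_multiples[of _ "\<lambda>A. A - A'"] prod_nonzero) (auto simp: inj_on_def)
  also have "dg S - h - degree (\<Prod>(S - H)) = dg H - h"
    using dg_Diff[of S H] HS by (simp add: degree_prod_S)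
  finally show ?thesis by (simp add: dgH)
qed auto

end

lemma sum_le_sum_classes:
  fixes F :: "'b \<Rightarrow> real"
  assumes "finite Z" "finite I" "\<kappa> ` Z \<subseteq> I"
    and "\<And>i. i \<in> I \<Longrightarrow> (\<Sum>z\<in>{z\<in>Z. \<kappa> z = i}. F z) \<le> b i"
  shows "sum F Z \<le> sum b I"
proof -
  have "sum F Z = (\<Sum>i\<in>I. \<Sum>z\<in>{z\<in>Z. \<kappa> z = i}. F z)"
    using assms by (simp add: sum.group)
  also have "\<dots> \<le> sum b I" using assms by (intro sum_mono) auto
  finally show ?thesis .
qed

context short_sums
begin

lemma q_ge_1 [simp]: "q \<ge> 1"
  using q_gt_1 by linarith

text \<open>The product of the two denominators exceeds that of the sum by
  \<open>q ^ overlap A B\<close> in norm. The extra factor uses up at most \<open>q ^ h\<close> of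
  this; the excess \<open>overlap A B - h\<close> remains to pay for the number of pairs.\<close>

lemma pair_term_le:
  assumes c: "c \<ge> 1"
  shows "q ^ min (overlap A B) h * wt c A * wt c B
           \<le> wt (c\<^sup>2) (A + B) * (c ^ (2 * card (cancel A B)) / q ^ (overlap A B - h))"
proof -
  define k where "k = card (nondiv A) + card (nondiv B)"
  have "q ^ min (overlap A B) h * wt c A * wt c B
          = c ^ k * q ^ min (overlap A B) h / q ^ (dg (nondiv A) + dg (nondiv B))"
    by (simp add: wt_def k_def power_add)
  also have "dg (nondiv A) + dg (nondiv B) =
      dg (nondiv (A + B)) + min (overlap A B) h + (overlap A B - h)"
    using dg_decomp(2)[of A B] by (simp add: min_def)
  also have "c ^ k * q ^ min (overlap A B) h /
      q ^ (dg (nondiv (A + B)) + min (overlap A B) h + (overlap A B - h))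
      = c ^ k / q ^ dg (nondiv (A + B)) / q ^ (overlap A B - h)"
    by (simp add: power_add)
  also have "\<dots> \<le> c ^ (2 * card (nondiv (A + B)) + 2 * card (cancel A B))
      / q ^ dg (nondiv (A + B)) / q ^ (overlap A B - h)"
    using card_nondiv_add_le[of A B] c
    by (intro divide_right_mono power_increasing) (auto simp: k_def)
  also have "\<dots> = wt (c\<^sup>2) (A + B) * (c ^ (2 * card (cancel A B)) / q ^ (overlap A B - h))"
    by (simp add: wt_def power_add power_mult)
  finally show ?thesis .
qed

lemma sum_subsets_eq_prod:
  "(\<Sum>T\<in>Pow S. c ^ (2 * card T) / q ^ dg T) = (\<Prod>P\<in>S. 1 + c\<^sup>2 / q ^ degree P)"
proof -
  have "(\<Prod>P\<in>S. c\<^sup>2 / q ^ degree P + 1) =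
      (\<Sum>T\<in>Pow S. (\<Prod>P\<in>T. c\<^sup>2 / q ^ degree P) * (\<Prod>P\<in>S - T. 1))"
    by (rule prod_add[OF fin])
  also have "\<dots> = (\<Sum>T\<in>Pow S. c ^ (2 * card T) / q ^ dg T)"
    by (simp add: prod_dividef dg_def power_sum power_mult)
  finally show ?thesis by (simp add: add.commute)
qed

text \<open>Pairs are split by the size of the common support. If its degree is below
  \<open>h\<close>, they are classified by \<open>X\<close>, \<open>Y\<close> and the degree of the
  cancelled part, which has at most \<open>h\<close> values; the class size cancels the denominator
  of \<open>E\<close>, so each class contributes at most \<open>L\<close>. Otherwise they are
  classified by \<open>X\<close>, \<open>Y\<close> and the cancelled set \<open>T\<close>, and a
  saving of \<open>q^(-dg T)\<close> turns the sum over \<open>T\<close> into an Euler product. The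
  \<open>4 ^ card U\<close> choices of \<open>X\<close> and \<open>Y\<close> change the parameter
  \<open>c\<^sup>2\<close> into \<open>4 * c\<^sup>2\<close>.\<close>

lemma pair_sum_le:
  assumes c: "c \<ge> 1"
    and L: "\<And>T. T \<subseteq> S \<Longrightarrow> dg T < h \<Longrightarrow> c ^ (2 * card T) \<le> L"
  shows "(\<Sum>A\<in>{A\<in>box. \<beta> - A \<in> box}. q ^ min (overlap A (\<beta> - A)) h * wt c A * wt c (\<beta> - A))
          \<le> (real h * L + (\<Prod>P\<in>S. 1 + c\<^sup>2 / q ^ degree P)) * wt (4 * c\<^sup>2) \<beta>"
proof -
  define U where "U = nondiv \<beta>"
  define M where "M = (\<Prod>P\<in>S. 1 + c\<^sup>2 / q ^ degree P)"
  define Z where "Z = {A\<in>box. \<beta> - A \<in> box}"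
  define X where "X A = nondiv A - nondiv (\<beta> - A)" for A
  define Y where "Y A = nondiv (\<beta> - A) - nondiv A" for A
  define g where "g A = cancel A (\<beta> - A)" for A
  define E where "E A = c ^ (2 * card (g A)) / q ^ (overlap A (\<beta> - A) - h)" for A
  define Z1 where "Z1 = {A\<in>Z. dg (common A (\<beta> - A)) < h}"
  define Z2 where "Z2 = {A\<in>Z. \<not> dg (common A (\<beta> - A)) < h}"
  have fin: "finite Z" "finite Z1" "finite Z2" "finite U"
    by (auto simp: Z_def Z1_def Z2_def U_def)
  have XY: "X A \<in> Pow U" "Y A \<in> Pow U" for A
    using nondiv_diff_subset[of A "\<beta> - A"] nondiv_diff_subset'[of "\<beta> - A" A]
    by (auto simp: X_def Y_def U_def)
  have gS: "g A \<subseteq> S" for A by (simp add: g_def cancel_subset)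
  have common_eq: "dg (common A (\<beta> - A)) = dg (U - X A - Y A) + dg (g A)" for A
    using dg_decomp(1)[of A "\<beta> - A"] by (simp add: U_def X_def Y_def g_def)
  have overlap_eq: "overlap A (\<beta> - A) = dg (U - X A - Y A) + 2 * dg (g A)" for A
    using common_eq[of A] by (simp add: overlap_def g_def)
  \<comment> \<open>For \<open>h = 0\<close> the assumption on \<open>L\<close> is void and
    \<open>L\<close> may be negative, but then no class of the first kind exists. Hence the detour
    through \<open>\<bar>L\<bar>\<close>.\<close>
  have L0: "h = 0 \<or> L \<ge> 0"
    using L[of "{}"] by (cases "h = 0") (auto simp: dg_def)
  have "sum E Z1 \<le> (\<Sum>i\<in>Pow U \<times> Pow U \<times> {..<h}. \<bar>L\<bar>)"
  proof (rule sum_le_sum_classes[where \<kappa> = "\<lambda>A. (X A, Y A, dg (g A))"])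
    show "(\<lambda>A. (X A, Y A, dg (g A))) ` Z1 \<subseteq> Pow U \<times> Pow U \<times> {..<h}"
      using XY common_eq by (auto simp: Z1_def)
    fix i assume "i \<in> Pow U \<times> Pow U \<times> {..<h}"
    obtain x y \<delta> where i: "i = (x, y, \<delta>)" by (cases i)
    define W where "W = {A\<in>Z1. (X A, Y A, dg (g A)) = i}"
    define k where "k = dg (U - x - y) + 2 * \<delta> - h"
    have "W \<subseteq> box" by (auto simp: W_def Z1_def Z_def)
    hence "card W \<le> CARD('a) ^ k"
      unfolding k_def U_def
      by (rule card_class_degree_le) (auto simp: W_def i X_def Y_def g_def)
    hence "real (card W) \<le> q ^ k" by (metis q_eq of_nat_le_iff of_nat_power)
    moreover have "E A \<le> \<bar>L\<bar> / q ^ k" if "A \<in> W" for A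
    proof -
      have "dg (g A) < h" using that common_eq[of A] by (simp add: W_def Z1_def)
      hence "c ^ (2 * card (g A)) \<le> \<bar>L\<bar>" using L[OF gS] by (smt (verit))
      moreover have "overlap A (\<beta> - A) - h = k"
        using that by (auto simp: W_def i overlap_eq k_def)
      ultimately show ?thesis by (simp add: E_def divide_right_mono)
    qed
    hence "sum E W \<le> real (card W) * (\<bar>L\<bar> / q ^ k)"
      by (rule sum_bounded_above)
    ultimately have "sum E W \<le> q ^ k * (\<bar>L\<bar> / q ^ k)"
      by (smt (verit) mult_right_mono divide_nonneg_nonneg zero_le_power q_nonneg)
    thus "(\<Sum>A\<in>{A\<in>Z1. (X A, Y A, dg (g A)) = i}. E A) \<le> \<bar>L\<bar>"
      by (simp add: W_def)
  qed (use fin in auto)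
  also have "\<dots> = 4 ^ card U * (real h * \<bar>L\<bar>)"
    using fin by (simp add: card_cartesian_product card_Pow power_mult_distrib flip: power_mult_distrib)
  finally have 1: "sum E Z1 \<le> 4 ^ card U * (real h * L)"
    using L0 by auto
  have "sum E Z2 \<le> (\<Sum>(x, y, T)\<in>Pow U \<times> Pow U \<times> Pow S. c ^ (2 * card T) / q ^ dg T)"
  proof (rule sum_le_sum_classes[where \<kappa> = "\<lambda>A. (X A, Y A, g A)"])
    show "(\<lambda>A. (X A, Y A, g A)) ` Z2 \<subseteq> Pow U \<times> Pow U \<times> Pow S"
      using XY gS by (simp add: image_subset_iff)
    fix i assume "i \<in> Pow U \<times> Pow U \<times> Pow S"
    obtain x y T where i: "i = (x, y, T)" by (cases i)
    define W where "W = {A\<in>Z2. (X A, Y A, g A) = i}"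
    define k where "k = dg (U - x - y) + dg T - h"
    have "W \<subseteq> box" by (auto simp: W_def Z2_def Z_def)
    hence "card W \<le> CARD('a) ^ k"
      unfolding k_def U_def
      by (rule card_class_cancel_le) (auto simp: W_def i X_def Y_def g_def)
    hence cW: "real (card W) \<le> q ^ k" by (metis q_eq of_nat_le_iff of_nat_power)
    have "E A \<le> c ^ (2 * card T) / q ^ (k + dg T)" if "A \<in> W" for A
    proof -
      \<comment> \<open>The common support has degree at least \<open>h\<close>, so the subtraction
        in \<open>k\<close> is exact and one \<open>dg T\<close> is left over.\<close>
      have "overlap A (\<beta> - A) - h = k + dg T"
        using that common_eq[of A] by (auto simp: W_def i overlap_eq k_def Z2_def)
      thus ?thesis using that by (simp add: E_def W_def i)
    qed
    hence "sum E W \<le> real (card W) * (c ^ (2 * card T) / q ^ (k + dg T))"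
      by (rule sum_bounded_above)
    also have "\<dots> \<le> q ^ k * (c ^ (2 * card T) / q ^ (k + dg T))"
      using cW c by (intro mult_right_mono) auto
    also have "\<dots> = c ^ (2 * card T) / q ^ dg T"
      by (simp add: power_add)
    finally show "(\<Sum>A\<in>{A\<in>Z2. (X A, Y A, g A) = i}. E A)
        \<le> (case i of (x, y, T) \<Rightarrow> c ^ (2 * card T) / q ^ dg T)"
      by (simp add: W_def i)
  qed (use fin finite_sub in auto)
  also have "\<dots> = (\<Sum>x\<in>Pow U. \<Sum>y\<in>Pow U. M)"
    unfolding M_def sum_subsets_eq_prod[symmetric] by (simp only: sum.cartesian_product[symmetric])
  also have "\<dots> = 4 ^ card U * M"
    using fin by (simp add: card_Pow power_mult_distrib flip: power_mult_distrib)
  finally have 2: "sum E Z2 \<le> 4 ^ card U * M" .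
  have "(\<Sum>A\<in>Z. q ^ min (overlap A (\<beta> - A)) h * wt c A * wt c (\<beta> - A))
      \<le> (\<Sum>A\<in>Z. wt (c\<^sup>2) \<beta> * E A)"
  proof (rule sum_mono)
    fix A
    show "q ^ min (overlap A (\<beta> - A)) h * wt c A * wt c (\<beta> - A) \<le> wt (c\<^sup>2) \<beta> * E A"
      using pair_term_le[OF c, of A "\<beta> - A"] by (simp add: E_def g_def)
  qed
  also have "\<dots> = wt (c\<^sup>2) \<beta> * (sum E Z1 + sum E Z2)"
  proof -
    have "Z = Z1 \<union> Z2" by (auto simp: Z1_def Z2_def)
    moreover have "Z1 \<inter> Z2 = {}" by (auto simp: Z1_def Z2_def)
    ultimately show ?thesis using fin by (simp add: sum.union_disjoint flip: sum_distrib_left)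
  qed
  also have "\<dots> \<le> wt (c\<^sup>2) \<beta> * (4 ^ card U * (real h * L) + 4 ^ card U * M)"
    using 1 2 by (intro mult_left_mono add_mono wt_nonneg) auto
  also have "\<dots> = (real h * L + M) * wt (4 * c\<^sup>2) \<beta>"
    by (simp add: wt_def U_def power_mult_distrib algebra_simps add_divide_distrib)
  finally show ?thesis by (simp add: Z_def M_def)
qed

end

subsection \<open>Zero sums of three and five fractions\<close>

text \<open>The local count at one prime: \<open>a\<close>, \<open>b\<close>, \<open>c\<close> say
  that it divides the three numerators, and \<open>s\<close>, \<open>t\<close>, \<open>u\<close>
  that it divides the sum of the other two. It never fails to divide exactly one of them. If it
  fails for two, their pair counts twice by cancellation; if it fails for all, there are three
  pairs.\<close>

lemma count_false3_le:
  assumes "b \<and> c \<longrightarrow> a" "c \<and> a \<longrightarrow> b" "a \<and> b \<longrightarrow> c"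
    and "a \<longrightarrow> s" "b \<longrightarrow> t" "c \<longrightarrow> u"
  shows "of_bool (\<not> a) + of_bool (\<not> b) + of_bool (\<not> c) \<le>
     (of_bool (\<not> b \<and> \<not> c) + of_bool (\<not> b \<and> \<not> c \<and> s)) +
     (of_bool (\<not> c \<and> \<not> a) + of_bool (\<not> c \<and> \<not> a \<and> t)) +
     (of_bool (\<not> a \<and> \<not> b) + of_bool (\<not> a \<and> \<not> b \<and> u) :: nat)"
  using assms by (cases a; cases b; cases c) simp_all

context short_sums
begin

definition pairs :: "'a poly \<Rightarrow> 'a poly set" where
  "pairs \<beta> = {A\<in>box. \<beta> - A \<in> box}"

definition pair_sum :: "real \<Rightarrow> 'a poly \<Rightarrow> real" where
  "pair_sum c \<beta> = (\<Sum>A\<in>pairs \<beta>. q ^ min (overlap A (\<beta> - A)) h * wt c A * wt c (\<beta> - A))"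

definition triples :: "('a poly \<times> 'a poly \<times> 'a poly) set" where
  "triples = {(x, y, z). x \<in> box \<and> y \<in> box \<and> z \<in> box \<and> x + y + z = 0}"

definition quintuples :: "('a poly \<times> 'a poly \<times> 'a poly \<times> 'a poly \<times> 'a poly) set" where
  "quintuples = {(x1, x2, x3, x4, x5). x1 \<in> box \<and> x2 \<in> box \<and> x3 \<in> box \<and> x4 \<in> box \<and> x5 \<in> box
     \<and> x1 + x2 + x3 + x4 + x5 = 0}"

lemma finite_pairs [simp]: "finite (pairs \<beta>)"
  by (simp add: pairs_def)

lemma finite_triples [simp]: "finite triples"
  by (rule finite_subset[of _ "box \<times> box \<times> box"]) (auto simp: triples_def)

lemma finite_quintuples [simp]: "finite quintuples"
  by (rule finite_subset[of _ "box \<times> box \<times> box \<times> box \<times> box"]) (auto simp: quintuples_def)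

text \<open>A nonzero fraction with denominator \<open>R\<close> has absolute value at least
  \<open>1 / |R|\<close>: the primes outside \<open>nondiv A\<close> all divide \<open>A\<close>, so
  their total degree is at most \<open>degree A\<close>.\<close>

lemma dg_nondiv_ge:
  assumes "A \<in> box"
  shows "dg (nondiv A) \<ge> h"
proof -
  have "\<Prod>(S - nondiv A) dvd A"
    by (rule prod_dvdI) (auto simp: nondiv_def)
  moreover have "A \<noteq> 0" "degree A < dg S - h" using assms by (auto simp: box_def lowdeg_def)
  ultimately have "dg (S - nondiv A) < dg S - h"
    using dvd_imp_degree_le[of "\<Prod>(S - nondiv A)" A] by (simp add: degree_prod_S)
  thus ?thesis using dg_Diff[of S "nondiv A"] nondiv_subset[of A] by simp
qed

lemma overlap_uminus_ge: "A \<in> box \<Longrightarrow> overlap A (- A) \<ge> h"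
  using dg_nondiv_ge[of A] by (simp add: overlap_def common_def cancel_def)

lemma dg_eq_sum_of_bool:
  "T \<subseteq> S \<Longrightarrow> dg T = (\<Sum>P\<in>S. degree P * of_bool (P \<in> T))"
  using fin by (simp add: dg_def of_bool_def if_distrib sum.If_cases Int_absorb1 cong: if_cong)

lemma overlap_eq_sum:
  "overlap A B = (\<Sum>P\<in>S. degree P * (of_bool (\<not> P dvd A \<and> \<not> P dvd B)
     + of_bool (\<not> P dvd A \<and> \<not> P dvd B \<and> P dvd A + B)))"
proof -
  have "common A B \<subseteq> S" using nondiv_subset by (auto simp: common_def)
  from dg_eq_sum_of_bool[OF this] show ?thesis
    unfolding overlap_def dg_eq_sum_of_bool[OF cancel_subset]
    by (simp only: sum.distrib[symmetric] distrib_left[symmetric], intro sum.cong,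
        auto simp: common_def cancel_def nondiv_def)
qed

lemma dg_nondiv_eq_sum: "dg (nondiv A) = (\<Sum>P\<in>S. degree P * of_bool (\<not> P dvd A))"
  unfolding dg_eq_sum_of_bool[OF nondiv_subset] by (intro sum.cong) (auto simp: nondiv_def)

lemma dvd_neg_of_sum_eq_0: "x + y = (0 :: 'a poly) \<Longrightarrow> P dvd x \<longleftrightarrow> P dvd y"
  by (metis add_eq_0_iff dvd_minus_iff)

lemma add3_eq_0_iff: "x + y + z = (0 :: 'a poly) \<longleftrightarrow> z = - x - y"
proof -
  have "x + y + z = z - (- x - y)" by (simp add: algebra_simps)
  thus ?thesis by (metis eq_iff_diff_eq_0)
qed

text \<open>Weighted by \<open>degree P\<close> and summed over all primes, the local count bounds
  the three denominator degrees, together at least \<open>3 * h\<close>, by the sum of the three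
  overlaps.\<close>

lemma exists_large_overlap_triple:
  assumes "(x, y, z) \<in> triples"
  shows "h \<le> overlap y z \<or> h \<le> overlap z x \<or> h \<le> overlap x y"
proof -
  have sum0: "x + y + z = 0" and box: "x \<in> box" "y \<in> box" "z \<in> box"
    using assms by (auto simp: triples_def)
  have *: "P dvd x \<longleftrightarrow> P dvd y + z" "P dvd y \<longleftrightarrow> P dvd z + x" "P dvd z \<longleftrightarrow> P dvd x + y" for P
    using sum0 by (auto intro!: dvd_neg_of_sum_eq_0 simp: algebra_simps)
  have pt: "of_bool (\<not> P dvd x) + of_bool (\<not> P dvd y) + of_bool (\<not> P dvd z) \<le>
     (of_bool (\<not> P dvd y \<and> \<not> P dvd z) + of_bool (\<not> P dvd y \<and> \<not> P dvd z \<and> P dvd y + z)) +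
     (of_bool (\<not> P dvd z \<and> \<not> P dvd x) + of_bool (\<not> P dvd z \<and> \<not> P dvd x \<and> P dvd z + x)) +
     (of_bool (\<not> P dvd x \<and> \<not> P dvd y) + of_bool (\<not> P dvd x \<and> \<not> P dvd y \<and> P dvd x + y) :: nat)" for P
  proof (rule count_false3_le)
    show "P dvd y \<and> P dvd z \<longrightarrow> P dvd x" using *(1)[of P] dvd_add by blast
    show "P dvd z \<and> P dvd x \<longrightarrow> P dvd y" using *(2)[of P] dvd_add by blast
    show "P dvd x \<and> P dvd y \<longrightarrow> P dvd z" using *(3)[of P] dvd_add by blast
  qed (use * in auto)
  have "dg (nondiv x) + dg (nondiv y) + dg (nondiv z) \<le> overlap y z + overlap z x + overlap x y"
    unfolding dg_nondiv_eq_sum overlap_eq_sum sum.distrib[symmetric] distrib_left[symmetric]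
    using pt by (intro sum_mono mult_left_mono) auto
  thus ?thesis using dg_nondiv_ge[OF box(1)] dg_nondiv_ge[OF box(2)] dg_nondiv_ge[OF box(3)]
    by linarith
qed

lemma sum_triples_rotate:
  "(\<Sum>(x, y, z)\<in>triples. f x y z) = (\<Sum>(x, y, z)\<in>triples. (f y z x :: real))"
  by (rule sum.reindex_bij_witness[of _ "\<lambda>(x, y, z). (y, z, x)" "\<lambda>(x, y, z). (z, x, y)"])
     (auto simp: triples_def algebra_simps)

lemma sum_triples_eq:
  "(\<Sum>(x, y, z)\<in>triples. (f x y z :: real)) = (\<Sum>x\<in>box. \<Sum>y\<in>pairs (- x). f x y (- x - y))"
proof -
  have "(\<Sum>(x, y, z)\<in>triples. f x y z) = (\<Sum>(x, y)\<in>(SIGMA x:box. pairs (- x)). f x y (- x - y))"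
    by (rule sum.reindex_bij_witness[of _ "\<lambda>(x, y). (x, y, - x - y)" "\<lambda>(x, y, z). (x, y)"])
       (auto simp: triples_def pairs_def add3_eq_0_iff)
  thus ?thesis by (simp add: sum.Sigma)
qed

definition triple_sum :: "real \<Rightarrow> real" where
  "triple_sum c = (\<Sum>(x, y, z)\<in>triples. wt c x * wt c y * wt c z)"

text \<open>At \<open>\<beta> = 0\<close> the pairs are \<open>A\<close> and \<open>- A\<close>,
  with overlap at least \<open>h\<close>. So the gain factor is exactly \<open>q ^ h\<close>, while
  \<open>wt d 0 = 1\<close>.\<close>

lemma sum_wt_squared_le:
  assumes "\<And>\<beta>. pair_sum c \<beta> \<le> K * wt d \<beta>"
  shows "(\<Sum>A\<in>box. wt c A * wt c A) \<le> K / q ^ h"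
proof -
  have "pairs 0 = box" by (auto simp: pairs_def box_def)
  hence "pair_sum c 0 = (\<Sum>A\<in>box. q ^ h * (wt c A * wt c A))"
    unfolding pair_sum_def using overlap_uminus_ge
    by (intro sum.cong) (simp_all add: min_absorb2)
  hence "q ^ h * (\<Sum>A\<in>box. wt c A * wt c A) \<le> K * wt d 0"
    using assms[of 0] by (simp add: sum_distrib_left)
  thus ?thesis by (simp add: wt_def dg_def field_simps)
qed

text \<open>Some overlap is at least \<open>h\<close>, so 1 is at most the sum of three factors
  \<open>\<phi>\<close>, whose contributions agree by rotation. In the presence of
  \<open>\<phi> y z\<close> the pair \<open>y\<close>, \<open>z\<close> collapses to
  \<open>- x\<close> with cost \<open>K\<close> and gain \<open>q ^ h\<close>. A diagonal sum over
  \<open>x\<close> remains and gives the second \<open>q ^ h\<close>.\<close>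

lemma triple_sum_le:
  assumes c: "0 \<le> c" "c \<le> d" and K: "K \<ge> 0"
    and pc: "\<And>\<beta>. pair_sum c \<beta> \<le> K * wt d \<beta>"
    and pd: "\<And>\<beta>. pair_sum d \<beta> \<le> K' * wt e \<beta>"
  shows "triple_sum c \<le> 3 * K * K' / (q ^ h * q ^ h)"
proof -
  define \<phi> where "\<phi> x y = q ^ min (overlap x y) h / q ^ h" for x y
  define W where "W x y z = wt c x * wt c y * wt c z" for x y z
  have \<phi>0: "\<phi> x y \<ge> 0" for x y by (simp add: \<phi>_def)
  have \<phi>1: "\<phi> x y = 1" if "h \<le> overlap x y" for x y using that by (simp add: \<phi>_def min_def)
  have W0: "W x y z \<ge> 0" for x y z using c wt_nonneg by (simp add: W_def)
  have "triple_sum c \<le> (\<Sum>(x, y, z)\<in>triples.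
      \<phi> y z * W x y z + \<phi> z x * W y z x + \<phi> x y * W z x y)"
    unfolding triple_sum_def
  proof (rule sum_mono)
    fix t assume t: "t \<in> triples"
    obtain x y z where xyz: "t = (x, y, z)" by (cases t)
    have "1 \<le> \<phi> y z + \<phi> z x + \<phi> x y"
      using exists_large_overlap_triple[of x y z] t \<phi>0[of y z] \<phi>0[of z x] \<phi>0[of x y] \<phi>1
      unfolding xyz by fastforce
    hence "1 * W x y z \<le> (\<phi> y z + \<phi> z x + \<phi> x y) * W x y z"
      using W0 by (intro mult_right_mono)
    thus "(case t of (x, y, z) \<Rightarrow> wt c x * wt c y * wt c z)
       \<le> (case t of (x, y, z) \<Rightarrow> \<phi> y z * W x y z + \<phi> z x * W y z x + \<phi> x y * W z x y)"
      by (simp add: xyz W_def algebra_simps)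
  qed
  also have "\<dots> = 3 * (\<Sum>(x, y, z)\<in>triples. \<phi> y z * W x y z)"
  proof -
    have "(\<Sum>(x, y, z)\<in>triples. \<phi> z x * W y z x) = (\<Sum>(x, y, z)\<in>triples. \<phi> y z * W x y z)"
      using sum_triples_rotate[of "\<lambda>x y z. \<phi> y z * W x y z"] by simp
    moreover have "(\<Sum>(x, y, z)\<in>triples. \<phi> x y * W z x y) = (\<Sum>(x, y, z)\<in>triples. \<phi> y z * W x y z)"
      using sum_triples_rotate[of "\<lambda>x y z. \<phi> x y * W z x y"] by simp
    ultimately show ?thesis by (simp add: case_prod_unfold sum.distrib)
  qed
  also have "(\<Sum>(x, y, z)\<in>triples. \<phi> y z * W x y z)
      = (\<Sum>x\<in>box. wt c x * pair_sum c (- x) / q ^ h)"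
    unfolding sum_triples_eq pair_sum_def sum_distrib_left sum_divide_distrib
    by (intro sum.cong) (auto simp: \<phi>_def W_def)
  also have "\<dots> \<le> (\<Sum>x\<in>box. wt d x * (K * wt d x) / q ^ h)"
  proof (intro sum_mono divide_right_mono)
    fix x
    show "wt c x * pair_sum c (- x) \<le> wt d x * (K * wt d x)"
      using pc[of "- x"] c K wt_nonneg[of c x] wt_nonneg[of d x] wt_mono[of c d x]
      by (intro order.trans[OF mult_left_mono mult_right_mono]) auto
  qed auto
  also have "\<dots> = K / q ^ h * (\<Sum>x\<in>box. wt d x * wt d x)"
    by (simp add: sum_distrib_left algebra_simps)
  also have "\<dots> \<le> K / q ^ h * (K' / q ^ h)"
    using sum_wt_squared_le[OF pd] K by (intro mult_left_mono) auto
  finally show ?thesis by (simp add: algebra_simps)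
qed

end

text \<open>The local count with all ten pairs; \<open>ob\<close> stands for \<open>of_bool\<close>.
  Let \<open>n\<close> be the number of numerators that the prime does not divide; it is never 1.
  For \<open>n \<ge> 3\<close> there are at least \<open>n\<close> pairs, and for
  \<open>n = 2\<close> the only pair counts twice because the other three are divisible.\<close>

lemma count_false5_le:
  fixes ob :: "bool \<Rightarrow> nat"
  assumes ob: "ob True = 1" "ob False = 0"
    and "a2 \<and> a3 \<and> a4 \<and> a5 \<longrightarrow> a1"
    and "a1 \<and> a3 \<and> a4 \<and> a5 \<longrightarrow> a2"
    and "a1 \<and> a2 \<and> a4 \<and> a5 \<longrightarrow> a3"
    and "a1 \<and> a2 \<and> a3 \<and> a5 \<longrightarrow> a4"
    and "a1 \<and> a2 \<and> a3 \<and> a4 \<longrightarrow> a5"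
  shows "ob (\<not> a1) + ob (\<not> a2) + ob (\<not> a3) + ob (\<not> a4) + ob (\<not> a5) \<le>
     ((ob (\<not> a2 \<and> \<not> a5) + ob (\<not> a2 \<and> \<not> a5 \<and> a1 \<and> a3 \<and> a4)) +
     (ob (\<not> a3 \<and> \<not> a4) + ob (\<not> a3 \<and> \<not> a4 \<and> a1 \<and> a2 \<and> a5)) +
     (ob (\<not> a3 \<and> \<not> a1) + ob (\<not> a3 \<and> \<not> a1 \<and> a2 \<and> a4 \<and> a5)) +
     (ob (\<not> a4 \<and> \<not> a5) + ob (\<not> a4 \<and> \<not> a5 \<and> a1 \<and> a2 \<and> a3)) +
     (ob (\<not> a4 \<and> \<not> a2) + ob (\<not> a4 \<and> \<not> a2 \<and> a1 \<and> a3 \<and> a5)) +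
     (ob (\<not> a5 \<and> \<not> a1) + ob (\<not> a5 \<and> \<not> a1 \<and> a2 \<and> a3 \<and> a4)) +
     (ob (\<not> a5 \<and> \<not> a3) + ob (\<not> a5 \<and> \<not> a3 \<and> a1 \<and> a2 \<and> a4)) +
     (ob (\<not> a1 \<and> \<not> a2) + ob (\<not> a1 \<and> \<not> a2 \<and> a3 \<and> a4 \<and> a5)) +
     (ob (\<not> a1 \<and> \<not> a4) + ob (\<not> a1 \<and> \<not> a4 \<and> a2 \<and> a3 \<and> a5)) +
     (ob (\<not> a2 \<and> \<not> a3) + ob (\<not> a2 \<and> \<not> a3 \<and> a1 \<and> a4 \<and> a5)))"
  by (insert assms(3-); cases a1; cases a2; cases a3; cases a4; cases a5; simp add: ob)

context short_sums
begin

text \<open>As for triples, the ten overlaps add up to at least \<open>5 * h\<close>. The ten pairs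
  split into five groups of two disjoint pairs, each group leaving out one index, so some group
  reaches \<open>h\<close>.\<close>

lemma exists_large_overlap_quintuple:
  assumes "(x1, x2, x3, x4, x5) \<in> quintuples"
  shows "h \<le> min (overlap x2 x5) h + min (overlap x3 x4) h
    \<or> h \<le> min (overlap x3 x1) h + min (overlap x4 x5) h
    \<or> h \<le> min (overlap x4 x2) h + min (overlap x5 x1) h
    \<or> h \<le> min (overlap x5 x3) h + min (overlap x1 x2) h
    \<or> h \<le> min (overlap x1 x4) h + min (overlap x2 x3) h"
proof -
  have sum0: "x1 + x2 + x3 + x4 + x5 = 0"
    and box: "x1 \<in> box" "x2 \<in> box" "x3 \<in> box" "x4 \<in> box" "x5 \<in> box"
    using assms by (auto simp: quintuples_def)
  \<comment> \<open>\<open>R P\<close> will say that \<open>P\<close> divides the other three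
    numerators, as the local count requires. By the zero sum this implies
    \<open>P dvd A + B\<close>, the condition for cancellation.\<close>
  define N where "N A B R = (\<Sum>P\<in>S. degree P * (of_bool (\<not> P dvd A \<and> \<not> P dvd B)
      + of_bool (\<not> P dvd A \<and> \<not> P dvd B \<and> R P)))" for A B and R :: "'a poly \<Rightarrow> bool"
  have "dg (nondiv x1) + dg (nondiv x2) + dg (nondiv x3) + dg (nondiv x4) + dg (nondiv x5) \<le>
    N x2 x5 (\<lambda>P. P dvd x1 \<and> P dvd x3 \<and> P dvd x4) +
    N x3 x4 (\<lambda>P. P dvd x1 \<and> P dvd x2 \<and> P dvd x5) +
    N x3 x1 (\<lambda>P. P dvd x2 \<and> P dvd x4 \<and> P dvd x5) +
    N x4 x5 (\<lambda>P. P dvd x1 \<and> P dvd x2 \<and> P dvd x3) +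
    N x4 x2 (\<lambda>P. P dvd x1 \<and> P dvd x3 \<and> P dvd x5) +
    N x5 x1 (\<lambda>P. P dvd x2 \<and> P dvd x3 \<and> P dvd x4) +
    N x5 x3 (\<lambda>P. P dvd x1 \<and> P dvd x2 \<and> P dvd x4) +
    N x1 x2 (\<lambda>P. P dvd x3 \<and> P dvd x4 \<and> P dvd x5) +
    N x1 x4 (\<lambda>P. P dvd x2 \<and> P dvd x3 \<and> P dvd x5) +
    N x2 x3 (\<lambda>P. P dvd x1 \<and> P dvd x4 \<and> P dvd x5)"
    unfolding dg_nondiv_eq_sum N_def sum.distrib[symmetric] distrib_left[symmetric]
  proof (intro sum_mono mult_left_mono)
    fix P
    have single: "P dvd x1 \<longleftrightarrow> P dvd x2 + x3 + x4 + x5"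
      "P dvd x2 \<longleftrightarrow> P dvd x1 + x3 + x4 + x5"
      "P dvd x3 \<longleftrightarrow> P dvd x1 + x2 + x4 + x5"
      "P dvd x4 \<longleftrightarrow> P dvd x1 + x2 + x3 + x5"
      "P dvd x5 \<longleftrightarrow> P dvd x1 + x2 + x3 + x4"
      using sum0 by (auto intro!: dvd_neg_of_sum_eq_0 simp: ac_simps)
    show "of_bool (\<not> P dvd x1) + of_bool (\<not> P dvd x2) + of_bool (\<not> P dvd x3) + of_bool (\<not> P dvd x4) + of_bool (\<not> P dvd x5) \<le>
     ((of_bool (\<not> P dvd x2 \<and> \<not> P dvd x5) + of_bool (\<not> P dvd x2 \<and> \<not> P dvd x5 \<and> P dvd x1 \<and> P dvd x3 \<and> P dvd x4)) +
     (of_bool (\<not> P dvd x3 \<and> \<not> P dvd x4) + of_bool (\<not> P dvd x3 \<and> \<not> P dvd x4 \<and> P dvd x1 \<and> P dvd x2 \<and> P dvd x5)) +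
     (of_bool (\<not> P dvd x3 \<and> \<not> P dvd x1) + of_bool (\<not> P dvd x3 \<and> \<not> P dvd x1 \<and> P dvd x2 \<and> P dvd x4 \<and> P dvd x5)) +
     (of_bool (\<not> P dvd x4 \<and> \<not> P dvd x5) + of_bool (\<not> P dvd x4 \<and> \<not> P dvd x5 \<and> P dvd x1 \<and> P dvd x2 \<and> P dvd x3)) +
     (of_bool (\<not> P dvd x4 \<and> \<not> P dvd x2) + of_bool (\<not> P dvd x4 \<and> \<not> P dvd x2 \<and> P dvd x1 \<and> P dvd x3 \<and> P dvd x5)) +
     (of_bool (\<not> P dvd x5 \<and> \<not> P dvd x1) + of_bool (\<not> P dvd x5 \<and> \<not> P dvd x1 \<and> P dvd x2 \<and> P dvd x3 \<and> P dvd x4)) +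
     (of_bool (\<not> P dvd x5 \<and> \<not> P dvd x3) + of_bool (\<not> P dvd x5 \<and> \<not> P dvd x3 \<and> P dvd x1 \<and> P dvd x2 \<and> P dvd x4)) +
     (of_bool (\<not> P dvd x1 \<and> \<not> P dvd x2) + of_bool (\<not> P dvd x1 \<and> \<not> P dvd x2 \<and> P dvd x3 \<and> P dvd x4 \<and> P dvd x5)) +
     (of_bool (\<not> P dvd x1 \<and> \<not> P dvd x4) + of_bool (\<not> P dvd x1 \<and> \<not> P dvd x4 \<and> P dvd x2 \<and> P dvd x3 \<and> P dvd x5)) +
     (of_bool (\<not> P dvd x2 \<and> \<not> P dvd x3) + of_bool (\<not> P dvd x2 \<and> \<not> P dvd x3 \<and> P dvd x1 \<and> P dvd x4 \<and> P dvd x5)) :: nat)"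
      by (rule count_false5_le) (simp_all only: of_bool_eq, (simp add: single)+)
  qed auto
  also have "\<dots> \<le> overlap x2 x5 + overlap x3 x4 + overlap x3 x1 + overlap x4 x5 + overlap x4 x2
      + overlap x5 x1 + overlap x5 x3 + overlap x1 x2 + overlap x1 x4 + overlap x2 x3"
  proof -
    have N_le: "N A B R \<le> overlap A B"
      if "A + B + C = 0" "\<And>P. R P \<Longrightarrow> P dvd C" for A B C R
    proof -
      have "P dvd A + B" if "R P" for P
        using dvd_neg_of_sum_eq_0[OF \<open>A + B + C = 0\<close>] \<open>R P \<Longrightarrow> P dvd C\<close> that by blast
      thus ?thesis unfolding N_def overlap_eq_sum
        by (intro sum_mono mult_left_mono add_mono) auto
    qed
    have le25: "N x2 x5 (\<lambda>P. P dvd x1 \<and> P dvd x3 \<and> P dvd x4) \<le> overlap x2 x5"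
      by (rule N_le[of _ _ "x1 + x3 + x4"]) (use sum0 in \<open>simp_all add: ac_simps\<close>)
    have le34: "N x3 x4 (\<lambda>P. P dvd x1 \<and> P dvd x2 \<and> P dvd x5) \<le> overlap x3 x4"
      by (rule N_le[of _ _ "x1 + x2 + x5"]) (use sum0 in \<open>simp_all add: ac_simps\<close>)
    have le31: "N x3 x1 (\<lambda>P. P dvd x2 \<and> P dvd x4 \<and> P dvd x5) \<le> overlap x3 x1"
      by (rule N_le[of _ _ "x2 + x4 + x5"]) (use sum0 in \<open>simp_all add: ac_simps\<close>)
    have le45: "N x4 x5 (\<lambda>P. P dvd x1 \<and> P dvd x2 \<and> P dvd x3) \<le> overlap x4 x5"
      by (rule N_le[of _ _ "x1 + x2 + x3"]) (use sum0 in \<open>simp_all add: ac_simps\<close>)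
    have le42: "N x4 x2 (\<lambda>P. P dvd x1 \<and> P dvd x3 \<and> P dvd x5) \<le> overlap x4 x2"
      by (rule N_le[of _ _ "x1 + x3 + x5"]) (use sum0 in \<open>simp_all add: ac_simps\<close>)
    have le51: "N x5 x1 (\<lambda>P. P dvd x2 \<and> P dvd x3 \<and> P dvd x4) \<le> overlap x5 x1"
      by (rule N_le[of _ _ "x2 + x3 + x4"]) (use sum0 in \<open>simp_all add: ac_simps\<close>)
    have le53: "N x5 x3 (\<lambda>P. P dvd x1 \<and> P dvd x2 \<and> P dvd x4) \<le> overlap x5 x3"
      by (rule N_le[of _ _ "x1 + x2 + x4"]) (use sum0 in \<open>simp_all add: ac_simps\<close>)
    have le12: "N x1 x2 (\<lambda>P. P dvd x3 \<and> P dvd x4 \<and> P dvd x5) \<le> overlap x1 x2"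
      by (rule N_le[of _ _ "x3 + x4 + x5"]) (use sum0 in \<open>simp_all add: ac_simps\<close>)
    have le14: "N x1 x4 (\<lambda>P. P dvd x2 \<and> P dvd x3 \<and> P dvd x5) \<le> overlap x1 x4"
      by (rule N_le[of _ _ "x2 + x3 + x5"]) (use sum0 in \<open>simp_all add: ac_simps\<close>)
    have le23: "N x2 x3 (\<lambda>P. P dvd x1 \<and> P dvd x4 \<and> P dvd x5) \<le> overlap x2 x3"
      by (rule N_le[of _ _ "x1 + x4 + x5"]) (use sum0 in \<open>simp_all add: ac_simps\<close>)
    show ?thesis
      by (intro add_mono le25 le34 le31 le45 le42 le51 le53 le12 le14 le23)
  qed
  finally have le: "dg (nondiv x1) + dg (nondiv x2) + dg (nondiv x3) + dg (nondiv x4) + dg (nondiv x5) \<le>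
    overlap x2 x5 + overlap x3 x4 + overlap x3 x1 + overlap x4 x5 + overlap x4 x2
      + overlap x5 x1 + overlap x5 x3 + overlap x1 x2 + overlap x1 x4 + overlap x2 x3" .
  have "5 * h \<le> dg (nondiv x1) + dg (nondiv x2) + dg (nondiv x3) + dg (nondiv x4) + dg (nondiv x5)"
    using box[THEN dg_nondiv_ge] by linarith
  with le have "h \<le> overlap x2 x5 + overlap x3 x4 \<or> h \<le> overlap x3 x1 + overlap x4 x5
    \<or> h \<le> overlap x4 x2 + overlap x5 x1 \<or> h \<le> overlap x5 x3 + overlap x1 x2
    \<or> h \<le> overlap x1 x4 + overlap x2 x3" by linarith
  \<comment> \<open>Capping is harmless: a term that is actually capped reaches \<open>h\<close>
    alone.\<close>
  moreover have "h \<le> min a h + min b h" if "h \<le> a + b" for a b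
    using that by (simp add: min_def)
  ultimately show ?thesis by blast
qed

lemma sum_quintuples_rotate:
  "(\<Sum>(x1, x2, x3, x4, x5)\<in>quintuples. f x1 x2 x3 x4 x5)
     = (\<Sum>(x1, x2, x3, x4, x5)\<in>quintuples. (f x2 x3 x4 x5 x1 :: real))"
  by (rule sum.reindex_bij_witness[of _ "\<lambda>(x1, x2, x3, x4, x5). (x2, x3, x4, x5, x1)"
        "\<lambda>(x1, x2, x3, x4, x5). (x5, x1, x2, x3, x4)"])
     (auto simp: quintuples_def ac_simps)

text \<open>The coordinates are \<open>x = x1\<close>, \<open>\<beta> = x2 + x5\<close> and one
  member of each of the pairs \<open>x2\<close>, \<open>x5\<close> and \<open>x3\<close>,
  \<open>x4\<close>. Since a pair may have sum zero, \<open>\<beta>\<close> runs through all of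
  \<open>lowdeg (dg S - h)\<close> and not only \<open>box\<close>.\<close>

lemma sum_quintuples_eq:
  "(\<Sum>(x1, x2, x3, x4, x5)\<in>quintuples. (f x1 x2 x3 x4 x5 :: real))
     = (\<Sum>x\<in>box. \<Sum>\<beta>\<in>lowdeg (dg S - h). \<Sum>y\<in>pairs \<beta>. \<Sum>z\<in>pairs (- x - \<beta>).
          f x y z (- x - \<beta> - z) (\<beta> - y))"
proof -
  have "(\<Sum>(x1, x2, x3, x4, x5)\<in>quintuples. f x1 x2 x3 x4 x5)
     = (\<Sum>(x, \<beta>, y, z)\<in>(SIGMA x:box. SIGMA \<beta>:lowdeg (dg S - h). pairs \<beta> \<times> pairs (- x - \<beta>)).
          f x y z (- x - \<beta> - z) (\<beta> - y))"
  proof (rule sum.reindex_bij_witness[of _ "\<lambda>(x, \<beta>, y, z). (x, y, z, - x - \<beta> - z, \<beta> - y)"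
        "\<lambda>(x1, x2, x3, x4, x5). (x1, x2 + x5, x2, x3)"])
    fix t assume "t \<in> quintuples"
    then obtain x1 x2 x3 x4 x5 where t: "t = (x1, x2, x3, x4, x5)"
      and box: "x1 \<in> box" "x2 \<in> box" "x3 \<in> box" "x4 \<in> box" "x5 \<in> box"
      and "x1 + x2 + x3 + x4 + x5 = 0"
      by (auto simp: quintuples_def)
    hence "x1 + (x2 + x5) + x3 + x4 = 0" by (simp add: algebra_simps)
    hence x4: "x4 = - x1 - (x2 + x5) - x3"
      using add3_eq_0_iff[of "x1 + (x2 + x5)" x3 x4] by (simp add: algebra_simps)
    have x5: "x2 + x5 - x2 = x5" by simp
    show "(case case t of (x1, x2, x3, x4, x5) \<Rightarrow> (x1, x2 + x5, x2, x3) of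
        (x, \<beta>, y, z) \<Rightarrow> (x, y, z, - x - \<beta> - z, \<beta> - y)) = t"
      by (simp add: t flip: x4)
    show "(case t of (x1, x2, x3, x4, x5) \<Rightarrow> (x1, x2 + x5, x2, x3))
        \<in> (SIGMA x:box. SIGMA \<beta>:lowdeg (dg S - h). pairs \<beta> \<times> pairs (- x - \<beta>))"
    proof -
      have "x3 \<in> pairs (- x1 - (x2 + x5))" "x2 \<in> pairs (x2 + x5)"
        using box by (simp_all add: pairs_def flip: x4)
      moreover have "x2 + x5 \<in> lowdeg (dg S - h)"
        using box by (auto simp: box_def intro: lowdeg_add)
      ultimately show ?thesis using box by (simp add: t)
    qed
    show "(case case t of (x1, x2, x3, x4, x5) \<Rightarrow> (x1, x2 + x5, x2, x3) of
        (x, \<beta>, y, z) \<Rightarrow> f x y z (- x - \<beta> - z) (\<beta> - y))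
        = (case t of (x1, x2, x3, x4, x5) \<Rightarrow> f x1 x2 x3 x4 x5)"
      by (simp add: t flip: x4)
  qed (auto simp: quintuples_def pairs_def algebra_simps)
  also have "\<dots> = (\<Sum>x\<in>box. \<Sum>\<beta>\<in>lowdeg (dg S - h). \<Sum>(y, z)\<in>pairs \<beta> \<times> pairs (- x - \<beta>).
          f x y z (- x - \<beta> - z) (\<beta> - y))"
    by (subst sum.Sigma[symmetric]; (subst sum.Sigma[symmetric])?; simp)
  finally show ?thesis by (simp add: sum.cartesian_product)
qed

definition quintuple_sum :: real where
  "quintuple_sum = (\<Sum>(x1, x2, x3, x4, x5)\<in>quintuples. wt 1 x1 * wt 1 x2 * wt 1 x3 * wt 1 x4 * wt 1 x5)"

definition pair_factor :: "'a poly \<Rightarrow> 'a poly \<Rightarrow> real" where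
  "pair_factor x y = q ^ min (overlap x y) h"

text \<open>
  A pair with vanishing sum is treated separately: it already contributes a factor \<open>q^(-h)\<close> and the
  other three fractions form a zero sum, so the overlap of the other pair must not be spent on it.
\<close>

definition two_pair_factor :: "'a poly \<Rightarrow> 'a poly \<Rightarrow> 'a poly \<Rightarrow> 'a poly \<Rightarrow> real" where
  "two_pair_factor x y z w =
     (if x + y = 0 then pair_factor x y
      else if z + w = 0 then pair_factor z w
      else pair_factor x y * pair_factor z w) / q ^ h"

lemma pair_factor_nonneg: "pair_factor x y \<ge> 0"
  by (simp add: pair_factor_def)

lemma two_pair_factor_nonneg: "two_pair_factor x y z w \<ge> 0"
  by (simp add: two_pair_factor_def pair_factor_nonneg)

text \<open>In the exceptional branches a pair \<open>u\<close>, \<open>- u\<close> from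
  \<open>box\<close> has overlap at least \<open>h\<close> and its factor is \<open>q ^ h\<close>;
  in the main branch the two exponents add up to at least \<open>h\<close>.\<close>

lemma two_pair_factor_ge_1:
  assumes "x \<in> box" "z \<in> box" "h \<le> min (overlap x y) h + min (overlap z w) h"
  shows "two_pair_factor x y z w \<ge> 1"
proof -
  have *: "pair_factor u v = q ^ h" if "u \<in> box" "u + v = 0" for u v
  proof -
    have "v = - u" using that by (simp add: add_eq_0_iff)
    thus ?thesis using overlap_uminus_ge[OF that(1)] by (simp add: pair_factor_def min_absorb2)
  qed
  have "q ^ h \<le> pair_factor x y * pair_factor z w"
    using assms(3) by (simp add: pair_factor_def power_increasing flip: power_add)
  thus ?thesis using *[OF assms(1)] *[OF assms(2)] by (simp add: two_pair_factor_def)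
qed

text \<open>For fixed \<open>x\<close> there are three kinds of \<open>\<beta>\<close>. If
  \<open>\<beta> = 0\<close> or \<open>\<beta> = - x\<close>, one pair has sum zero and contributes
  at most \<open>K\<close>, and the other three numerators form a zero-sum triple. Otherwise both
  pairs collapse, at cost \<open>K\<^sup>2\<close>, to the triple \<open>x\<close>,
  \<open>\<beta>\<close>, \<open>- x - \<beta>\<close>.\<close>

lemma quintuple_sum_le_main:
  assumes K: "K \<ge> 0" and d: "d \<ge> 1"
    and p1: "\<And>\<beta>. pair_sum 1 \<beta> \<le> K * wt d \<beta>"
  shows "(\<Sum>(x1, x2, x3, x4, x5)\<in>quintuples. two_pair_factor x2 x5 x3 x4 *
      (wt 1 x1 * wt 1 x2 * wt 1 x3 * wt 1 x4 * wt 1 x5))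
    \<le> (2 * K + K\<^sup>2) * triple_sum d / q ^ h"
proof -
  define p where "p x y = pair_factor x y * wt 1 x * wt 1 y" for x y
  define D where "D = lowdeg (dg S - h) - {0 :: 'a poly}"
  have D: "D = box" by (simp add: D_def box_def)
  define I where "I x \<beta> = (\<Sum>y\<in>pairs \<beta>. \<Sum>z\<in>pairs (- x - \<beta>).
      two_pair_factor y (\<beta> - y) z (- x - \<beta> - z) *
        (wt 1 x * wt 1 y * wt 1 z * wt 1 (- x - \<beta> - z) * wt 1 (\<beta> - y)))" for x \<beta>
  define W where "W \<beta> = (\<Sum>y\<in>pairs \<beta>. wt 1 y * wt 1 (\<beta> - y))" for \<beta>
  have W0: "W \<beta> \<ge> 0" for \<beta> by (auto simp: W_def intro!: sum_nonneg wt_nonneg mult_nonneg_nonneg)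
  have p_eq: "pair_sum 1 \<beta> = (\<Sum>y\<in>pairs \<beta>. p y (\<beta> - y))" for \<beta>
    by (simp add: pair_sum_def p_def pair_factor_def)
  have p0: "pair_sum 1 0 \<le> K" using p1[of 0] by (simp add: wt_def dg_def)
  have p_nonneg: "pair_sum 1 \<beta> \<ge> 0" for \<beta>
    unfolding p_eq p_def by (intro sum_nonneg mult_nonneg_nonneg wt_nonneg pair_factor_nonneg) auto
  have I0: "I x 0 \<le> K * (wt 1 x * W (- x)) / q ^ h" for x
  proof -
    have "I x 0 = pair_sum 1 0 * (wt 1 x * W (- x)) / q ^ h"
      unfolding I_def p_eq W_def sum_distrib_left sum_distrib_right sum_divide_distrib
      by (subst sum.swap) (intro sum.cong refl; simp add: two_pair_factor_def p_def)+
    also have "\<dots> \<le> K * (wt 1 x * W (- x)) / q ^ h"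
      using p0 W0 wt_nonneg[of 1 x] by (intro divide_right_mono mult_right_mono) auto
    finally show ?thesis .
  qed
  have I1: "I x (- x) \<le> K * (wt 1 x * W (- x)) / q ^ h" if "x \<in> box" for x
  proof -
    \<comment> \<open>So \<open>\<beta> = - x\<close> is nonzero and the second branch of
      \<open>two_pair_factor\<close> applies.\<close>
    have "x \<noteq> 0" using that by (simp add: box_def)
    hence "I x (- x) = pair_sum 1 0 * (wt 1 x * W (- x)) / q ^ h"
      unfolding I_def p_eq W_def sum_distrib_left sum_distrib_right sum_divide_distrib
      by (intro sum.cong refl; simp add: two_pair_factor_def p_def)+
    also have "\<dots> \<le> K * (wt 1 x * W (- x)) / q ^ h"
      using p0 W0 wt_nonneg[of 1 x] by (intro divide_right_mono mult_right_mono) auto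
    finally show ?thesis .
  qed
  have I2: "I x \<beta> \<le> K\<^sup>2 * (wt d x * wt d \<beta> * wt d (- x - \<beta>)) / q ^ h"
    if "\<beta> \<noteq> 0" "\<beta> \<noteq> - x" for x \<beta>
  proof -
    have "- x - \<beta> \<noteq> 0" using that(2) by (metis eq_iff_diff_eq_0)
    hence "I x \<beta> = wt 1 x * (\<Sum>y\<in>pairs \<beta>. \<Sum>z\<in>pairs (- x - \<beta>).
        p y (\<beta> - y) * p z (- x - \<beta> - z)) / q ^ h"
      unfolding I_def sum_distrib_left sum_divide_distrib using that(1)
      by (intro sum.cong refl) (simp add: two_pair_factor_def p_def)
    also have "\<dots> = wt 1 x * pair_sum 1 \<beta> * pair_sum 1 (- x - \<beta>) / q ^ h"
      by (simp add: p_eq flip: sum_product)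
    also have "\<dots> \<le> wt d x * (K * wt d \<beta>) * (K * wt d (- x - \<beta>)) / q ^ h"
      using p1 K d p_nonneg wt_nonneg[of d] wt_mono[of 1 d]
      by (intro divide_right_mono mult_mono mult_nonneg_nonneg) auto
    finally show ?thesis by (simp add: power2_eq_square algebra_simps)
  qed
  have main: "(\<Sum>\<beta>\<in>lowdeg (dg S - h). I x \<beta>) \<le>
      2 * K * (wt 1 x * W (- x)) / q ^ h
      + K\<^sup>2 * (\<Sum>\<beta>\<in>pairs (- x). wt d x * wt d \<beta> * wt d (- x - \<beta>)) / q ^ h"
    if x: "x \<in> box" for x
  proof -
    have sub: "lowdeg (dg S - h) = insert 0 (insert (- x) (pairs (- x)))"
      using x by (auto simp: pairs_def box_def intro: lowdeg_diff)
    have ni: "0 \<notin> insert (- x) (pairs (- x))" "- x \<notin> pairs (- x)"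
      using x by (auto simp: pairs_def box_def)
    have "(\<Sum>\<beta>\<in>lowdeg (dg S - h). I x \<beta>) = I x 0 + (I x (- x) + (\<Sum>\<beta>\<in>pairs (- x). I x \<beta>))"
      unfolding sub using ni by (subst sum.insert; simp)+
    also have "(\<Sum>\<beta>\<in>pairs (- x). I x \<beta>) \<le>
        (\<Sum>\<beta>\<in>pairs (- x). K\<^sup>2 * (wt d x * wt d \<beta> * wt d (- x - \<beta>)) / q ^ h)"
      using ni by (intro sum_mono I2) auto
    also have "\<dots> = K\<^sup>2 * (\<Sum>\<beta>\<in>pairs (- x). wt d x * wt d \<beta> * wt d (- x - \<beta>)) / q ^ h"
      by (simp add: sum_distrib_left sum_divide_distrib)
    finally show ?thesis using I0[of x] I1[OF x] by simp
  qed
  have tr: "triple_sum c = (\<Sum>x\<in>box. \<Sum>\<beta>\<in>pairs (- x). wt c x * wt c \<beta> * wt c (- x - \<beta>))" for c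
    unfolding triple_sum_def by (rule sum_triples_eq)
  have "(\<Sum>(x1, x2, x3, x4, x5)\<in>quintuples. two_pair_factor x2 x5 x3 x4 *
      (wt 1 x1 * wt 1 x2 * wt 1 x3 * wt 1 x4 * wt 1 x5))
      = (\<Sum>x\<in>box. \<Sum>\<beta>\<in>lowdeg (dg S - h). I x \<beta>)"
    unfolding sum_quintuples_eq I_def ..
  also have "\<dots> \<le> (\<Sum>x\<in>box. 2 * K * (wt 1 x * W (- x)) / q ^ h
      + K\<^sup>2 * (\<Sum>\<beta>\<in>pairs (- x). wt d x * wt d \<beta> * wt d (- x - \<beta>)) / q ^ h)"
    by (intro sum_mono main)
  also have "\<dots> = 2 * K * triple_sum 1 / q ^ h + K\<^sup>2 * triple_sum d / q ^ h"
    unfolding tr W_def sum.distrib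
    by (simp add: sum_distrib_left sum_divide_distrib mult.assoc)
  also have "triple_sum 1 \<le> triple_sum d"
    unfolding tr using d wt_nonneg[of 1] wt_nonneg[of d] wt_mono[of 1 d]
    by (intro sum_mono mult_mono mult_nonneg_nonneg) auto
  hence "2 * K * triple_sum 1 / q ^ h \<le> 2 * K * triple_sum d / q ^ h"
    using K by (intro divide_right_mono mult_left_mono) auto
  finally show ?thesis by (simp add: algebra_simps add_divide_distrib)
qed

text \<open>At each quintuple one of the five rotated factors is at least 1, and summation over
  \<open>quintuples\<close> is invariant under rotation; hence the constant 5.\<close>

lemma quintuple_sum_le:
  assumes K: "K \<ge> 0" and d: "d \<ge> 1"
    and p1: "\<And>\<beta>. pair_sum 1 \<beta> \<le> K * wt d \<beta>"
  shows "quintuple_sum \<le> 5 * (2 * K + K\<^sup>2) * triple_sum d / q ^ h"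
proof -
  define F where "F x1 x2 x3 x4 x5 = two_pair_factor x2 x5 x3 x4 *
      (wt 1 x1 * wt 1 x2 * wt 1 x3 * wt 1 x4 * wt 1 x5)" for x1 x2 x3 x4 x5
  define T where "T = (\<Sum>(x1, x2, x3, x4, x5)\<in>quintuples. F x1 x2 x3 x4 x5)"
  have rot: "(\<Sum>(x1, x2, x3, x4, x5)\<in>quintuples. F x2 x3 x4 x5 x1) = T"
    "(\<Sum>(x1, x2, x3, x4, x5)\<in>quintuples. F x3 x4 x5 x1 x2) = T"
    "(\<Sum>(x1, x2, x3, x4, x5)\<in>quintuples. F x4 x5 x1 x2 x3) = T"
    "(\<Sum>(x1, x2, x3, x4, x5)\<in>quintuples. F x5 x1 x2 x3 x4) = T"
    unfolding T_def
    using sum_quintuples_rotate[of F] sum_quintuples_rotate[of "\<lambda>x1 x2 x3 x4 x5. F x2 x3 x4 x5 x1"]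
      sum_quintuples_rotate[of "\<lambda>x1 x2 x3 x4 x5. F x3 x4 x5 x1 x2"]
      sum_quintuples_rotate[of "\<lambda>x1 x2 x3 x4 x5. F x4 x5 x1 x2 x3"]
    by simp_all
  have "quintuple_sum \<le> (\<Sum>(x1, x2, x3, x4, x5)\<in>quintuples.
      F x1 x2 x3 x4 x5 + F x2 x3 x4 x5 x1 + F x3 x4 x5 x1 x2 + F x4 x5 x1 x2 x3 + F x5 x1 x2 x3 x4)"
    unfolding quintuple_sum_def
  proof (rule sum_mono)
    fix t assume "t \<in> quintuples"
    then obtain x1 x2 x3 x4 x5 where t: "t = (x1, x2, x3, x4, x5)"
      and q5: "(x1, x2, x3, x4, x5) \<in> quintuples" by (cases t) auto
    have box: "x1 \<in> box" "x2 \<in> box" "x3 \<in> box" "x4 \<in> box" "x5 \<in> box"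
      using q5 by (auto simp: quintuples_def)
    define W where "W = wt 1 x1 * wt 1 x2 * wt 1 x3 * wt 1 x4 * wt 1 x5"
    have W0: "W \<ge> 0" unfolding W_def by (intro mult_nonneg_nonneg wt_nonneg) auto
    define f1 where "f1 = two_pair_factor x2 x5 x3 x4"
    define f2 where "f2 = two_pair_factor x3 x1 x4 x5"
    define f3 where "f3 = two_pair_factor x4 x2 x5 x1"
    define f4 where "f4 = two_pair_factor x5 x3 x1 x2"
    define f5 where "f5 = two_pair_factor x1 x4 x2 x3"
    have nn: "f1 \<ge> 0" "f2 \<ge> 0" "f3 \<ge> 0" "f4 \<ge> 0" "f5 \<ge> 0"
      by (simp_all add: f1_def f2_def f3_def f4_def f5_def two_pair_factor_nonneg)
    have "f1 \<ge> 1 \<or> f2 \<ge> 1 \<or> f3 \<ge> 1 \<or> f4 \<ge> 1 \<or> f5 \<ge> 1"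
      using exists_large_overlap_quintuple[OF q5] box two_pair_factor_ge_1
      unfolding f1_def f2_def f3_def f4_def f5_def by blast
    hence "1 \<le> f1 + f2 + f3 + f4 + f5" using nn by linarith
    hence "1 * W \<le> (f1 + f2 + f3 + f4 + f5) * W" using W0 by (rule mult_right_mono)
    moreover have "F x1 x2 x3 x4 x5 = f1 * W" "F x2 x3 x4 x5 x1 = f2 * W" "F x3 x4 x5 x1 x2 = f3 * W"
      "F x4 x5 x1 x2 x3 = f4 * W" "F x5 x1 x2 x3 x4 = f5 * W"
      unfolding F_def f1_def f2_def f3_def f4_def f5_def W_def by (simp_all only: ac_simps)
    ultimately show "(case t of (x1, x2, x3, x4, x5) \<Rightarrow> wt 1 x1 * wt 1 x2 * wt 1 x3 * wt 1 x4 * wt 1 x5)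
       \<le> (case t of (x1, x2, x3, x4, x5) \<Rightarrow>
      F x1 x2 x3 x4 x5 + F x2 x3 x4 x5 x1 + F x3 x4 x5 x1 x2 + F x4 x5 x1 x2 x3 + F x5 x1 x2 x3 x4)"
      by (simp add: t distrib_right flip: W_def)
  qed
  also have "\<dots> = 5 * T"
    using rot unfolding T_def by (simp add: case_prod_unfold sum.distrib)
  also have "T \<le> (2 * K + K\<^sup>2) * triple_sum d / q ^ h"
    unfolding T_def F_def using assms by (rule quintuple_sum_le_main)
  finally show ?thesis by (simp only: mult.assoc times_divide_eq_right)
qed

end

subsection \<open>Fourier expansion of the moment\<close>

text \<open>For a maximal proper additive subgroup \<open>H\<close> and \<open>x\<close> outside it,
  every \<open>y\<close> lies in \<open>k x + H\<close> for an integer \<open>k\<close> that is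
  unique modulo the characteristic \<open>p\<close>. The character sends \<open>y\<close> to the
  root of unity \<open>exp (2 \<pi> i k / p)\<close>.\<close>

lemma exists_additive_character:
  "\<exists>\<psi> :: 'a::{field, finite} \<Rightarrow> complex. (\<forall>x y. \<psi> (x + y) = \<psi> x * \<psi> y) \<and> \<psi> 0 = 1 \<and> (\<exists>x. \<psi> x \<noteq> 1)"
proof -
  define p where "p = int CHAR('a)"
  have p: "prime p"
    using prime_CHAR_semidom[where 'a = 'a] finite_imp_CHAR_pos[where 'a = 'a] by (simp add: p_def)
  define sub where "sub H \<longleftrightarrow> 0 \<in> H \<and> (\<forall>x\<in>H. \<forall>y\<in>H. x - y \<in> H)" for H :: "'a set"
  have "{0} \<in> {H. sub H \<and> H \<noteq> UNIV}"
  proof -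
    have "(1 :: 'a) \<notin> {0}" by simp
    hence "{0 :: 'a} \<noteq> UNIV" by blast
    thus ?thesis by (simp add: sub_def)
  qed
  then obtain H where H: "sub H" "H \<noteq> UNIV" and max: "\<And>H'. sub H' \<Longrightarrow> H' \<noteq> UNIV \<Longrightarrow> H \<subseteq> H' \<Longrightarrow> H = H'"
    using finite_has_maximal[of "{H. sub H \<and> H \<noteq> UNIV}"] by auto
  have H0: "0 \<in> H" and Hdiff: "\<And>x y. x \<in> H \<Longrightarrow> y \<in> H \<Longrightarrow> x - y \<in> H"
    using H(1) by (auto simp: sub_def)
  have Hminus: "- x \<in> H" if "x \<in> H" for x using Hdiff[OF H0 that] by simp
  have Hadd: "x + y \<in> H" if "x \<in> H" "y \<in> H" for x y using Hdiff[OF that(1) Hminus[OF that(2)]] by simp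
  have Hnat: "of_nat k * x \<in> H" if "x \<in> H" for k x
    by (induction k) (auto simp: distrib_right H0 Hadd that)
  have Hint: "of_int k * x \<in> H" if "x \<in> H" for k x
    using Hnat[OF that] Hminus by (cases k rule: int_cases2) auto
  from H(2) obtain x where x: "x \<notin> H" by blast
  define H' where "H' = {a + of_int k * x |a k. a \<in> H}"
  have "sub H'" unfolding sub_def
  proof (intro conjI ballI)
    show "0 \<in> H'" unfolding H'_def using H0 by (auto intro!: exI[of _ 0])
    fix y z assume "y \<in> H'" "z \<in> H'"
    then obtain a k b l where "y = a + of_int k * x" "z = b + of_int l * x" "a \<in> H" "b \<in> H"
      by (auto simp: H'_def)
    hence "y - z = (a - b) + of_int (k - l) * x" "a - b \<in> H"
      by (auto simp: algebra_simps Hdiff)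
    thus "y - z \<in> H'" unfolding H'_def by blast
  qed
  moreover have "H \<subseteq> H'"
  proof
    fix y assume "y \<in> H"
    moreover have "y = y + of_int 0 * x" by simp
    ultimately show "y \<in> H'" unfolding H'_def by blast
  qed
  moreover have "x \<in> H'"
  proof -
    have "x = 0 + of_int 1 * x" by simp
    thus ?thesis unfolding H'_def using H0 by blast
  qed
  ultimately have "H' = UNIV" using max[of H'] x by blast
  hence ex: "\<exists>k. y - of_int k * x \<in> H" for y
  proof -
    have "y \<in> H'" using \<open>H' = UNIV\<close> by simp
    then obtain a k where "y = a + of_int k * x" "a \<in> H" by (auto simp: H'_def)
    hence "y - of_int k * x \<in> H" by simp
    thus ?thesis ..
  qed
  \<comment> \<open>Otherwise Bezout's identity and \<open>p x = 0\<close> make \<open>x\<close> a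
    multiple of \<open>k x\<close>, hence an element of \<open>H\<close>.\<close>
  have dvd: "p dvd k" if "of_int k * x \<in> H" for k
  proof (rule ccontr)
    assume "\<not> p dvd k"
    hence "coprime p k" using p by (simp add: prime_imp_coprime)
    then obtain u v where "u * p + v * k = 1" using bezout_int[of p k] by auto
    hence "of_int (u * p + v * k) * x = x" by simp
    moreover have "(of_int p :: 'a) = 0" by (simp add: p_def)
    ultimately have "of_int v * (of_int k * x) = x" by (simp add: algebra_simps)
    thus False using Hint[OF that, of v] x by (simp only:)
  qed
  define e where "e k = cis (2 * pi * (real_of_int k / real_of_int p))" for k
  have e_add: "e (k + l) = e k * e l" for k l
    by (simp add: e_def cis_mult add_divide_distrib algebra_simps)
  have e_dvd: "e k = 1" if "p dvd k" for k
  proof -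
    from that obtain j where "k = p * j" by blast
    hence "real_of_int k / real_of_int p = real_of_int j" using p by auto
    thus ?thesis by (simp add: e_def cis_multiple_2pi)
  qed
  define \<psi> where "\<psi> y = e (SOME k. y - of_int k * x \<in> H)" for y
  have \<psi>: "\<psi> y = e k" if "y - of_int k * x \<in> H" for y k
  proof -
    define l where "l = (SOME k. y - of_int k * x \<in> H)"
    have "y - of_int l * x \<in> H" unfolding l_def by (rule someI_ex[OF ex])
    from Hdiff[OF that this] have "of_int (l - k) * x \<in> H" by (simp add: algebra_simps)
    hence "e (l - k) = 1" using dvd e_dvd by blast
    thus ?thesis using e_add[of "l - k" k] by (simp add: \<psi>_def l_def)
  qed
  have "\<psi> (y + z) = \<psi> y * \<psi> z" for y z
  proof -
    obtain k l where kl: "y - of_int k * x \<in> H" "z - of_int l * x \<in> H" using ex by blast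
    hence "y + z - of_int (k + l) * x \<in> H" using Hadd[OF kl] by (simp add: algebra_simps)
    from \<psi>[OF this] \<psi>[OF kl(1)] \<psi>[OF kl(2)] show ?thesis by (simp only: e_add)
  qed
  moreover have "\<psi> 0 = 1" using \<psi>[of 0 0] H0 by (simp add: e_def)
  moreover have "\<psi> x \<noteq> 1"
  proof -
    have "p \<ge> 2" using p prime_ge_2_int by blast
    hence "cos (2 * pi * (1 / real_of_int p)) < cos 0"
      by (intro cos_monotone_0_pi) (auto simp: field_simps)
    hence "e 1 \<noteq> 1" by (auto simp: e_def complex_eq_iff)
    thus ?thesis using \<psi>[of x 1] H0 by simp
  qed
  ultimately show ?thesis by blast
qed

text \<open>Translation by \<open>B\<close> permutes \<open>H\<close> and multiplies the sum by
  \<open>f B\<close>.\<close>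

lemma sum_character_eq_0:
  fixes f :: "'b::ab_group_add \<Rightarrow> complex"
  assumes "finite H" "\<And>A. A \<in> H \<Longrightarrow> A + B \<in> H" "\<And>A. f (A + B) = f A * f B" "f B \<noteq> 1"
  shows "sum f H = 0"
proof -
  have "inj_on (\<lambda>A. A + B) H" by (simp add: inj_on_def)
  hence "(\<lambda>A. A + B) ` H = H" using assms by (intro endo_inj_surj) auto
  hence "sum f H = (\<Sum>A\<in>H. f (A + B))"
    using \<open>inj_on (\<lambda>A. A + B) H\<close> by (metis (no_types, lifting) sum.reindex_cong)
  also have "\<dots> = f B * sum f H" by (simp add: assms sum_distrib_left mult.commute)
  finally show ?thesis using assms(4) by simp
qed

text \<open>Nonemptiness gives \<open>dg S > 0\<close>, so that \<open>dg S - 1\<close> is the index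
  of the top coefficient of residues modulo \<open>\<Prod>S\<close>.\<close>

locale short_sums_character = short_sums S h q for S :: "'a::{field, finite} poly set" and h q +
  fixes \<psi> :: "'a \<Rightarrow> complex"
  assumes \<psi>_add: "\<psi> (x + y) = \<psi> x * \<psi> y"
    and \<psi>_0: "\<psi> 0 = 1"
    and \<psi>_nontrivial: "\<exists>x. \<psi> x \<noteq> 1"
    and S_nonempty: "S \<noteq> {}"
begin

text \<open>The character \<open>X \<mapsto> e(X / Q)\<close> for \<open>Q = \<Prod>S\<close>: the residue at infinity of \<open>X / Q\<close> is
  the top coefficient of \<open>X mod Q\<close>.\<close>

definition ee :: "'a poly \<Rightarrow> complex" where
  "ee X = \<psi> (coeff (X mod \<Prod>S) (dg S - 1))"

lemma dg_S_pos: "dg S > 0"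
  using S_nonempty degree_pos_S fin by (auto simp: dg_def intro!: sum_pos)

lemma degree_prod_all: "degree (\<Prod>S) = dg S"
  by (simp add: degree_prod_S)

lemma ee_add: "ee (X + Y) = ee X * ee Y"
  by (simp add: ee_def poly_mod_add_left \<psi>_add)

lemma ee_dvd: "\<Prod>S dvd X \<Longrightarrow> ee X = 1"
  by (simp add: ee_def \<psi>_0 dvd_imp_mod_0)

lemma ee_mod_mult: "ee ((X mod \<Prod>S) * Y) = ee (X * Y)"
  by (simp add: ee_def mod_mult_left_eq)

text \<open>The monomial moves the leading coefficient of the residue of \<open>X\<close> to the
  index \<open>dg S - 1\<close> and scales it to a point where \<open>\<psi>\<close> is not 1. The
  exponent is explicit because the witness must have small degree in sums over short
  intervals.\<close>

lemma ee_nondegenerate: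
  assumes "\<not> \<Prod>S dvd X"
  shows "\<exists>c. ee (X * monom c (dg S - 1 - degree (X mod \<Prod>S))) \<noteq> 1"
proof -
  define Y where "Y = X mod \<Prod>S"
  define k where "k = dg S - 1 - degree Y"
  from \<psi>_nontrivial obtain x where x: "\<psi> x \<noteq> 1" by blast
  define c where "c = x / lead_coeff Y"
  have Y: "Y \<noteq> 0" using assms by (simp add: Y_def mod_eq_0_iff_dvd)
  hence "degree Y < dg S"
    using degree_mod_less'[of "\<Prod>S" X] prod_nonzero[of S] degree_prod_all by (simp add: Y_def)
  hence k: "k + degree Y = dg S - 1" by (simp add: k_def)
  have "c \<noteq> 0" using x \<psi>_0 Y by (auto simp: c_def)
  hence "degree (Y * monom c k) = dg S - 1"
    using Y k by (simp add: degree_mult_eq degree_monom_eq)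
  hence "(Y * monom c k) mod \<Prod>S = Y * monom c k"
    using dg_S_pos by (intro mod_poly_less) (simp add: degree_prod_all)
  moreover have "coeff (Y * monom c k) (dg S - 1) = x"
    unfolding k[symmetric] using Y by (subst mult.commute) (simp add: coeff_monom_mult c_def)
  ultimately have "ee (Y * monom c k) = \<psi> x" by (simp add: ee_def)
  thus ?thesis using x ee_mod_mult[of X "monom c k"] unfolding Y_def k_def by auto
qed

lemma lowdeg_iff_mod: "A \<in> lowdeg (dg S) \<longleftrightarrow> A mod \<Prod>S = A"
proof
  assume "A mod \<Prod>S = A"
  thus "A \<in> lowdeg (dg S)"
    using degree_mod_less[of "\<Prod>S" A] prod_nonzero[of S] by (auto simp: lowdeg_def degree_prod_all)
qed (auto simp: lowdeg_def mod_poly_less degree_prod_all)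

text \<open>The sum detects \<open>|A / \<Prod>S| < q^(-k)\<close>. For such \<open>A\<close> all
  terms are 1; otherwise the monomial at which the character is nontrivial has degree below
  \<open>k\<close>, and translation by it kills the sum.\<close>

lemma sum_ee_lowdeg:
  assumes A: "A \<in> lowdeg (dg S)"
  shows "(\<Sum>v\<in>lowdeg k. ee (A * v)) = (if A \<in> lowdeg (dg S - k) then complex_of_real (q ^ k) else 0)"
proof (cases "A \<in> lowdeg (dg S - k)")
  case True
  have "ee (A * v) = 1" if "v \<in> lowdeg k" for v
  proof (cases "A = 0 \<or> v = 0")
    case False
    hence *: "degree A < dg S - k" "degree v < k" using True that by (auto simp: lowdeg_def)
    \<comment> \<open>Both bounds are strict, so the product has degree at most
      \<open>dg S - 2\<close> and misses the coefficient that \<open>ee\<close> reads.\<close>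
    hence deg: "degree (A * v) < dg S - 1" using degree_mult_le[of A v] by linarith
    hence "(A * v) mod \<Prod>S = A * v" by (intro mod_poly_less) (simp add: degree_prod_all)
    thus ?thesis using deg by (simp add: ee_def coeff_eq_0 \<psi>_0)
  qed (auto simp: ee_dvd)
  thus ?thesis using True by (simp add: card_lowdeg q_eq)
next
  case False
  hence "A \<noteq> 0" "degree A \<ge> dg S - k" "degree A < dg S" using A by (auto simp: lowdeg_def)
  moreover have mod: "A mod \<Prod>S = A" using A lowdeg_iff_mod by blast
  ultimately have "\<not> \<Prod>S dvd A" by (auto dest: dvd_imp_mod_0)
  from ee_nondegenerate[OF this] obtain c
    where c: "ee (A * monom c (dg S - 1 - degree A)) \<noteq> 1" by (auto simp: mod)
  define B where "B = monom c (dg S - 1 - degree A)"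
  have cB: "ee (A * B) \<noteq> 1" using c unfolding B_def .
  have "degree B < k"
    using degree_monom_le[of c "dg S - 1 - degree A"] \<open>degree A \<ge> dg S - k\<close> \<open>degree A < dg S\<close>
    by (simp add: B_def)
  hence B: "B \<in> lowdeg k" by (simp add: lowdeg_def)
  have "(\<Sum>v\<in>lowdeg k. ee (A * v)) = 0"
    using cB B by (intro sum_character_eq_0[where B = B])
      (auto simp: distrib_left ee_add intro: lowdeg_add)
  thus ?thesis using False by simp
qed

text \<open>Orthogonality modulo \<open>\<Prod>T\<close>: the numerators in question are the
  multiples of \<open>\<Prod>(S - T)\<close>, so the fractions are those of the form
  \<open>t / \<Prod>T\<close>.\<close>

lemma sum_ee_multiples:
  assumes T: "T \<subseteq> S"
  shows "(\<Sum>A\<in>{A\<in>lowdeg (dg S). nondiv A \<subseteq> T}. ee (A * G))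
           = (if \<Prod>T dvd G then complex_of_real (q ^ dg T) else 0)"
proof -
  define Z where "Z = \<Prod>(S - T)"
  define H where "H = {A\<in>lowdeg (dg S). nondiv A \<subseteq> T}"
  have H: "H = {A\<in>lowdeg (dg S). Z dvd A}"
    unfolding H_def Z_def by (subst prod_dvd_iff) (auto simp: nondiv_def)
  have Z0: "Z \<noteq> 0" unfolding Z_def by (rule prod_nonzero) auto
  have split: "\<Prod>S = Z * \<Prod>T"
    unfolding Z_def using T fin by (simp add: prod.subset_diff)
  have degZ: "dg S = degree Z + dg T"
    using dg_Diff[of S T] T by (simp add: Z_def degree_prod_S)
  show ?thesis unfolding H_def[symmetric]
  proof (cases "\<Prod>T dvd G")
    case True
    have "H = (\<lambda>t. Z * t) ` lowdeg (dg T)"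
    proof (intro equalityI subsetI)
      fix A assume "A \<in> H"
      then obtain t where t: "A = Z * t" "Z * t \<in> lowdeg (dg S)" by (auto simp: H)
      hence "t \<in> lowdeg (dg T)"
        using Z0 by (cases "t = 0") (auto simp: lowdeg_def degree_mult_eq degZ)
      thus "A \<in> (\<lambda>t. Z * t) ` lowdeg (dg T)" using t by blast
    next
      fix A assume "A \<in> (\<lambda>t. Z * t) ` lowdeg (dg T)"
      then obtain t where "A = Z * t" "t \<in> lowdeg (dg T)" by blast
      thus "A \<in> H"
        using Z0 by (cases "t = 0") (auto simp: H lowdeg_def degree_mult_eq degZ)
    qed
    moreover have "inj_on (\<lambda>t. Z * t) (lowdeg (dg T))" using Z0 by (simp add: inj_on_def)
    ultimately have "card H = CARD('a) ^ dg T" by (simp add: card_image card_lowdeg)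
    moreover have "ee (A * G) = 1" if "A \<in> H" for A
      using that True unfolding H by (intro ee_dvd) (simp add: split mult_dvd_mono)
    ultimately show "(\<Sum>A\<in>H. ee (A * G)) = (if \<Prod>T dvd G then complex_of_real (q ^ dg T) else 0)"
      using True by (simp add: q_eq)
  next
    case False
    hence "\<not> \<Prod>S dvd Z * G" using Z0 by (simp add: split)
    from ee_nondegenerate[OF this] obtain C where C: "ee (Z * G * C) \<noteq> 1" by blast
    define B where "B = (Z * C) mod \<Prod>S"
    have "ee (B * G) \<noteq> 1"
      using C unfolding B_def ee_mod_mult by (simp add: ac_simps)
    moreover have "B \<in> lowdeg (dg S)" by (simp add: B_def lowdeg_iff_mod)
    moreover have "Z dvd B" unfolding B_def by (intro dvd_mod) (simp_all add: split)
    ultimately have "(\<Sum>A\<in>H. ee (A * G)) = 0"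
      unfolding H by (intro sum_character_eq_0[where B = B])
        (auto simp: distrib_right ee_add intro: lowdeg_add)
    thus "(\<Sum>A\<in>H. ee (A * G)) = (if \<Prod>T dvd G then complex_of_real (q ^ dg T) else 0)"
      using False by simp
  qed
qed

lemma is_unit_of_dvd_prod:
  assumes "T \<subseteq> S" "D dvd \<Prod>T" "\<And>P. P \<in> T \<Longrightarrow> \<not> P dvd D"
  shows "D dvd 1"
  using finite_sub[OF assms(1)] assms
proof (induction T rule: finite_induct)
  case (insert P T)
  hence "D dvd P * \<Prod>T" by simp
  then obtain E where E: "P * \<Prod>T = D * E" by (rule dvdE)
  have "P dvd D * E" by (simp flip: E)
  moreover have "prime_elem P" using insert prime_elem_S by auto
  ultimately have "P dvd E" using insert.prems(3)[of P] prime_elem_dvd_multD by blast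
  then obtain E' where "E = P * E'" by blast
  with E have "\<Prod>T = D * E'" using insert.prems nonzero_S[of P] by simp
  thus ?case using insert by (intro insert.IH) auto
qed simp

lemma coprime_prod_iff: "coprime G (\<Prod>S) \<longleftrightarrow> (\<forall>P\<in>S. \<not> P dvd G)"
proof
  assume *: "coprime G (\<Prod>S)"
  show "\<forall>P\<in>S. \<not> P dvd G"
  proof safe
    fix P assume P: "P \<in> S" "P dvd G"
    hence "P dvd \<Prod>S" by (simp add: dvd_prod_S_iff)
    with * P have "P dvd 1" using coprime_common_divisor by blast
    thus False using irred[OF P(1)] by (simp add: irreducible_def)
  qed
next
  assume *: "\<forall>P\<in>S. \<not> P dvd G"
  show "coprime G (\<Prod>S)"
  proof (rule coprimeI)
    fix D assume "D dvd G" "D dvd \<Prod>S"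
    thus "D dvd 1" using * by (intro is_unit_of_dvd_prod[of S]) (auto dest: dvd_trans)
  qed
qed

text \<open>The Fourier coefficient of the indicator of coprimality to \<open>\<Prod>S\<close> at
  the frequency \<open>A / \<Prod>S\<close>, as a Moebius sum over the divisors that are multiples
  of the reduced denominator.\<close>

definition chat :: "'a poly \<Rightarrow> real" where
  "chat A = (\<Sum>T\<in>{T\<in>Pow S. nondiv A \<subseteq> T}. (-1) ^ card T / q ^ dg T)"

text \<open>The product of \<open>1 - of_bool (P dvd G)\<close> expands over subsets
  \<open>T\<close>, and each condition \<open>\<Prod>T dvd G\<close> expands in characters;
  exchanging the sums collects \<open>chat A\<close>.\<close>

lemma coprime_eq_sum_ee:
  "of_bool (coprime G (\<Prod>S)) = (\<Sum>A\<in>lowdeg (dg S). complex_of_real (chat A) * ee (A * G))"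
proof -
  have "of_bool (coprime G (\<Prod>S)) = (\<Prod>P\<in>S. 1 - of_bool (P dvd G) :: complex)"
    unfolding coprime_prod_iff using fin by (auto simp: prod_zero_iff)
  also have "\<dots> = (\<Sum>T\<in>Pow S. (-1) ^ card T * (\<Prod>P\<in>T. of_bool (P dvd G)) * (\<Prod>P\<in>S - T. 1))"
    by (rule prod_diff_conv_sum[OF fin])
  also have "\<dots> = (\<Sum>T\<in>Pow S. (-1) ^ card T / q ^ dg T *
      (\<Sum>A\<in>{A\<in>lowdeg (dg S). nondiv A \<subseteq> T}. ee (A * G)))"
  proof (rule sum.cong)
    fix T assume "T \<in> Pow S"
    hence T: "T \<subseteq> S" by simp
    have "(\<Prod>P\<in>T. of_bool (P dvd G)) = (of_bool (\<Prod>T dvd G) :: complex)"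
      using finite_sub[OF T] by (auto simp: prod_dvd_iff[OF T] prod_zero_iff)
    thus "(-1) ^ card T * (\<Prod>P\<in>T. of_bool (P dvd G)) * (\<Prod>P\<in>S - T. 1)
        = complex_of_real ((-1) ^ card T / q ^ dg T) *
            (\<Sum>A\<in>{A\<in>lowdeg (dg S). nondiv A \<subseteq> T}. ee (A * G))"
      unfolding sum_ee_multiples[OF T] by simp
  qed auto
  also have "\<dots> = (\<Sum>T\<in>Pow S. \<Sum>A\<in>lowdeg (dg S). if nondiv A \<subseteq> T
      then complex_of_real ((-1) ^ card T / q ^ dg T) * ee (A * G) else 0)"
    by (simp add: sum_distrib_left sum.If_cases Int_def conj_commute cong: conj_cong)
  also have "\<dots> = (\<Sum>A\<in>lowdeg (dg S). \<Sum>T\<in>Pow S. if nondiv A \<subseteq> T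
      then complex_of_real ((-1) ^ card T / q ^ dg T) * ee (A * G) else 0)"
    by (rule sum.swap)
  also have "\<dots> = (\<Sum>A\<in>lowdeg (dg S). complex_of_real (chat A) * ee (A * G))"
    using fin by (simp add: chat_def sum_distrib_right sum.If_cases Int_def)
  finally show ?thesis .
qed

text \<open>Each \<open>T\<close> above the support \<open>U\<close> is \<open>U\<close> joined with
  a subset of \<open>S - U\<close>. Hence \<open>chat A\<close> is, up to sign,
  \<open>1 / |R|\<close> times a product of factors \<open>1 - 1 / |P|\<close>, which lie between 0
  and 1; here \<open>R\<close> is the reduced denominator.\<close>

lemma abs_chat_le: "\<bar>chat A\<bar> \<le> wt 1 A"
proof -
  define U where "U = nondiv A"
  have U: "U \<subseteq> S" "finite U" by (simp_all add: U_def nondiv_subset)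
  have "chat A = (\<Sum>T\<in>Pow (S - U). (-1) ^ card (U \<union> T) / q ^ dg (U \<union> T))"
    unfolding chat_def U_def[symmetric]
    by (rule sum.reindex_bij_witness[of _ "\<lambda>T. U \<union> T" "\<lambda>T. T - U"]) (use U in \<open>auto simp: Un_absorb1\<close>)
  also have "\<dots> = (\<Sum>T\<in>Pow (S - U). (-1) ^ card U / q ^ dg U * ((-1) ^ card T / q ^ dg T))"
  proof (rule sum.cong)
    fix T assume "T \<in> Pow (S - U)"
    hence T: "T \<subseteq> S" "U \<inter> T = {}" "finite T" using finite_sub by auto
    show "(-1) ^ card (U \<union> T) / q ^ dg (U \<union> T) = (-1) ^ card U / q ^ dg U * ((-1) ^ card T / q ^ dg T)"
      using T U by (simp add: card_Un_disjoint dg_Un power_add)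
  qed auto
  also have "\<dots> = (-1) ^ card U / q ^ dg U * (\<Prod>P\<in>S - U. 1 - 1 / q ^ degree P)"
  proof -
    have "(\<Prod>P\<in>S - U. 1 - 1 / q ^ degree P) =
        (\<Sum>T\<in>Pow (S - U). (-1) ^ card T * (\<Prod>P\<in>T. 1 / q ^ degree P) * (\<Prod>P\<in>S - U - T. 1))"
      using fin by (intro prod_diff_conv_sum) auto
    also have "\<dots> = (\<Sum>T\<in>Pow (S - U). (-1) ^ card T / q ^ dg T)"
      by (simp add: prod_dividef dg_def power_sum)
    finally show ?thesis by (simp add: sum_distrib_left)
  qed
  finally have eq: "chat A = (-1) ^ card U / q ^ dg U * (\<Prod>P\<in>S - U. 1 - 1 / q ^ degree P)" .
  have "0 \<le> 1 - 1 / q ^ degree P \<and> 1 - 1 / q ^ degree P \<le> 1" for P :: "'a poly"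
    using one_le_power[OF q_ge_1, of "degree P"] by (simp add: field_simps)
  hence "\<bar>\<Prod>P\<in>S - U. 1 - 1 / q ^ degree P\<bar> \<le> 1"
    by (simp add: abs_prod prod_le_1)
  thus ?thesis unfolding eq
    by (simp add: abs_mult power_abs wt_def divide_right_mono flip: U_def)
qed

lemma residue_polys_prod: "residue_polys (\<Prod>S) = lowdeg (dg S)"
  by (simp add: residue_polys_def lowdeg_def degree_prod_all)

lemma pnorm_prod: "real (pnorm (\<Prod>S)) = q ^ dg S"
  using prod_nonzero[of S] by (simp add: pnorm_def degree_prod_all q_eq)

text \<open>Over a full residue system only the frequency 0 survives, so \<open>chat 0\<close> is
  the density of residues coprime to \<open>\<Prod>S\<close>.\<close>

lemma poly_phi_prod: "real (poly_phi (\<Prod>S)) = q ^ dg S * chat 0"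
proof -
  have "complex_of_real (real (poly_phi (\<Prod>S))) = (\<Sum>G\<in>lowdeg (dg S). of_bool (coprime G (\<Prod>S)))"
    by (simp add: poly_phi_def residue_polys_prod of_bool_def sum.If_cases Int_def)
  also have "\<dots> = (\<Sum>A\<in>lowdeg (dg S). complex_of_real (chat A) * (\<Sum>G\<in>lowdeg (dg S). ee (A * G)))"
    unfolding coprime_eq_sum_ee sum_distrib_left by (rule sum.swap)
  also have "\<dots> = (\<Sum>A\<in>lowdeg (dg S). if A = (0 :: 'a poly) then complex_of_real (chat 0 * q ^ dg S) else 0)"
    by (intro sum.cong refl) (auto simp: sum_ee_lowdeg, auto simp: lowdeg_def)
  also have "\<dots> = complex_of_real (q ^ dg S * chat 0)" by (simp add: mult.commute)
  finally show ?thesis by (simp only: of_real_eq_iff)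
qed

text \<open>Summation over the interval keeps only the frequencies below \<open>q^(-h)\<close>, each
  with factor \<open>q ^ h\<close>. The frequency 0 gives exactly the expected count, which is why
  \<open>box\<close> omits it.\<close>

lemma deviation_eq_sum_ee:
  "complex_of_real (real (card {G \<in> short_interval F h. coprime G (\<Prod>S)})
      - real (CARD('a) ^ h) * real (poly_phi (\<Prod>S)) / real (pnorm (\<Prod>S)))
    = q ^ h * (\<Sum>A\<in>box. complex_of_real (chat A) * ee (A * F))"
proof -
  have interval: "short_interval F h = (\<lambda>v. F + v) ` lowdeg h"
  proof (intro equalityI subsetI)
    fix G assume "G \<in> short_interval F h"
    hence "F - G \<in> lowdeg h"
      using card_field_gt_1[where 'a = 'a]
      by (auto simp: short_interval_def pnorm_def lowdeg_def split: if_splits)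
    hence "G - F \<in> lowdeg h" using lowdeg_uminus_iff[of "F - G" h] by simp
    moreover have "G = F + (G - F)" by simp
    ultimately show "G \<in> (\<lambda>v. F + v) ` lowdeg h" by blast
  next
    fix G assume "G \<in> (\<lambda>v. F + v) ` lowdeg h"
    thus "G \<in> short_interval F h"
      using card_field_gt_1[where 'a = 'a] by (auto simp: short_interval_def pnorm_def lowdeg_def)
  qed
  have "{G \<in> short_interval F h. coprime G (\<Prod>S)} = (\<lambda>v. F + v) ` {v\<in>lowdeg h. coprime (F + v) (\<Prod>S)}"
    unfolding interval by auto
  hence "card {G \<in> short_interval F h. coprime G (\<Prod>S)} = card {v\<in>lowdeg h. coprime (F + v) (\<Prod>S)}"
    by (simp add: card_image)
  hence "complex_of_nat (card {G \<in> short_interval F h. coprime G (\<Prod>S)})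
      = (\<Sum>v\<in>lowdeg h. of_bool (coprime (F + v) (\<Prod>S)))"
    by (simp add: of_bool_def sum.If_cases Int_def)
  also have "\<dots> = (\<Sum>A\<in>lowdeg (dg S). \<Sum>v\<in>lowdeg h. complex_of_real (chat A) * ee (A * (F + v)))"
    unfolding coprime_eq_sum_ee by (rule sum.swap)
  also have "\<dots> = (\<Sum>A\<in>lowdeg (dg S). complex_of_real (chat A) * ee (A * F) * (\<Sum>v\<in>lowdeg h. ee (A * v)))"
    by (simp add: distrib_left ee_add sum_distrib_left mult.assoc)
  also have "\<dots> = (\<Sum>A\<in>lowdeg (dg S). if A \<in> lowdeg (dg S - h)
      then q ^ h * (complex_of_real (chat A) * ee (A * F)) else 0)"
    by (intro sum.cong refl) (simp add: sum_ee_lowdeg)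
  also have "\<dots> = (\<Sum>A\<in>lowdeg (dg S - h). q ^ h * (complex_of_real (chat A) * ee (A * F)))"
    by (rule sum.mono_neutral_cong_right) (auto intro: lowdeg_mono[of "dg S - h"])
  also have "\<dots> = q ^ h * (chat 0 + (\<Sum>A\<in>box. complex_of_real (chat A) * ee (A * F)))"
    unfolding box_def by (subst sum.remove[of _ 0]) (auto simp: ee_dvd distrib_left sum_distrib_left)
  finally have "complex_of_nat (card {G \<in> short_interval F h. coprime G (\<Prod>S)}) =
      q ^ h * (chat 0 + (\<Sum>A\<in>box. complex_of_real (chat A) * ee (A * F)))" .
  thus ?thesis
    by (simp add: pnorm_prod poly_phi_prod distrib_left flip: q_eq)
qed

lemma fifth_power_sum:
  fixes u :: "'b \<Rightarrow> 'c::comm_semiring_1"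
  shows "(\<Sum>A\<in>B. u A) ^ 5 =
    (\<Sum>(x1, x2, x3, x4, x5)\<in>B \<times> B \<times> B \<times> B \<times> B. u x1 * u x2 * u x3 * u x4 * u x5)"
proof -
  have *: "sum u B * sum v C = (\<Sum>(x, t)\<in>B \<times> C. u x * v t)" for v :: "'d \<Rightarrow> 'c" and C
    by (simp add: sum_product sum.cartesian_product)
  have "(\<Sum>A\<in>B. u A) ^ 5 = sum u B * (sum u B * (sum u B * (sum u B * sum u B)))"
    by (simp add: eval_nat_numeral ac_simps)
  thus ?thesis unfolding * by (simp add: case_prod_unfold mult.assoc)
qed

text \<open>Expanding the fifth power and summing over all residues leaves the quintuples of sum
  zero; the triangle inequality then gives up all signs.\<close>

lemma abs_m5_le: "\<bar>m5 (\<Prod>S) h\<bar> \<le> q ^ dg S * q ^ (5 * h) * quintuple_sum"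
proof -
  define B5 where "B5 = box \<times> box \<times> box \<times> box \<times> box"
  define g where "g t = (case t of (x1, x2, x3, x4, x5) \<Rightarrow>
      chat x1 * chat x2 * chat x3 * chat x4 * chat x5)" for t
  define \<sigma> where "\<sigma> t = (case t of (x1, x2, x3, x4, x5) \<Rightarrow> x1 + x2 + x3 + x4 + x5)"
    for t :: "'a poly \<times> 'a poly \<times> 'a poly \<times> 'a poly \<times> 'a poly"
  \<comment> \<open>The sum of the five numerators has degree below \<open>dg S\<close>, so it is
    divisible by \<open>\<Prod>S\<close> only if it is zero.\<close>
  have \<sigma>: "\<sigma> t \<in> lowdeg (dg S)" if "t \<in> B5" for t
    using that by (auto simp: \<sigma>_def B5_def box_def intro!: lowdeg_add lowdeg_mono[of "dg S - h" "dg S"])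
  have "complex_of_real (m5 (\<Prod>S) h) = (\<Sum>F\<in>lowdeg (dg S).
      (q ^ h * (\<Sum>A\<in>box. complex_of_real (chat A) * ee (A * F))) ^ 5)"
    unfolding m5_def residue_polys_prod of_real_sum of_real_power deviation_eq_sum_ee ..
  also have "\<dots> = (\<Sum>F\<in>lowdeg (dg S). q ^ (5 * h) * (\<Sum>t\<in>B5. complex_of_real (g t) * ee (\<sigma> t * F)))"
  proof (intro sum.cong refl)
    fix F
    have "(\<Sum>A\<in>box. complex_of_real (chat A) * ee (A * F)) ^ 5
        = (\<Sum>t\<in>B5. complex_of_real (g t) * ee (\<sigma> t * F))"
      unfolding fifth_power_sum B5_def
      by (intro sum.cong refl) (auto simp: g_def \<sigma>_def ee_add algebra_simps)
    thus "(q ^ h * (\<Sum>A\<in>box. complex_of_real (chat A) * ee (A * F))) ^ 5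
        = q ^ (5 * h) * (\<Sum>t\<in>B5. complex_of_real (g t) * ee (\<sigma> t * F))"
      by (simp add: power_mult_distrib mult.commute flip: power_mult)
  qed
  also have "\<dots> = q ^ (5 * h) * (\<Sum>t\<in>B5. complex_of_real (g t) * (\<Sum>F\<in>lowdeg (dg S). ee (\<sigma> t * F)))"
    unfolding sum_distrib_left[symmetric] by (subst sum.swap) (simp add: sum_distrib_left)
  also have "(\<Sum>t\<in>B5. complex_of_real (g t) * (\<Sum>F\<in>lowdeg (dg S). ee (\<sigma> t * F)))
      = (\<Sum>t\<in>B5. if \<sigma> t = 0 then complex_of_real (g t * q ^ dg S) else 0)"
    by (intro sum.cong refl) (auto simp: sum_ee_lowdeg \<sigma>, auto simp: lowdeg_def)
  also have "\<dots> = (\<Sum>t\<in>quintuples. complex_of_real (g t * q ^ dg S))"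
  proof -
    have "{t \<in> B5. \<sigma> t = 0} = quintuples" by (auto simp: B5_def \<sigma>_def quintuples_def)
    thus ?thesis by (simp add: sum.If_cases Int_def B5_def)
  qed
  also have "q ^ (5 * h) * \<dots> = complex_of_real (q ^ dg S * q ^ (5 * h) * (\<Sum>t\<in>quintuples. g t))"
    by (simp add: sum_distrib_left sum_distrib_right mult_ac)
  finally have "m5 (\<Prod>S) h = q ^ dg S * q ^ (5 * h) * (\<Sum>t\<in>quintuples. g t)"
    by (simp only: of_real_eq_iff)
  moreover have "\<bar>\<Sum>t\<in>quintuples. g t\<bar> \<le> quintuple_sum"
    unfolding quintuple_sum_def
  proof (rule order.trans[OF sum_abs], rule sum_mono)
    fix t
    show "\<bar>g t\<bar> \<le> (case t of (x1, x2, x3, x4, x5) \<Rightarrow> wt 1 x1 * wt 1 x2 * wt 1 x3 * wt 1 x4 * wt 1 x5)"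
      by (cases t) (auto simp: g_def abs_mult intro!: mult_mono abs_chat_le mult_nonneg_nonneg wt_nonneg)
  qed
  ultimately show ?thesis by (simp add: abs_mult)
qed

end

subsection \<open>Sums over irreducible polynomials\<close>

definition monic_polys :: "nat \<Rightarrow> 'a::{field, finite} poly set" where
  "monic_polys m = {F. degree F = m \<and> lead_coeff F = 1}"

lemma monic_polys_eq: "monic_polys m = (\<lambda>F. monom 1 m + F) ` lowdeg m"
proof (intro equalityI subsetI)
  fix F :: "'a poly" assume "F \<in> monic_polys m"
  hence "F - monom 1 m \<in> lowdeg m"
    by (auto simp: monic_polys_def lowdeg_iff_coeff coeff_eq_0 le_eq_less_or_eq)
  moreover have "F = monom 1 m + (F - monom 1 m)" by simp
  ultimately show "F \<in> (\<lambda>F. monom 1 m + F) ` lowdeg m" by blast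
next
  fix F :: "'a poly" assume "F \<in> (\<lambda>F. monom 1 m + F) ` lowdeg m"
  then obtain G where G: "F = monom 1 m + G" "G \<in> lowdeg m" by blast
  hence "coeff F k = (if k = m then 1 else 0)" if "k \<ge> m" for k
    using that by (auto simp: lowdeg_iff_coeff)
  hence "coeff F m = 1" "\<And>k. k > m \<Longrightarrow> coeff F k = 0" by auto
  moreover from this have "degree F = m"
    by (intro antisym degree_le le_degree) auto
  ultimately show "F \<in> monic_polys m" by (simp add: monic_polys_def)
qed

lemma finite_monic_polys [simp]: "finite (monic_polys m)"
  by (simp add: monic_polys_eq)

lemma card_monic_polys: "card (monic_polys m :: 'a::{field, finite} poly set) = CARD('a) ^ m"
  unfolding monic_polys_eq by (subst card_image) (simp_all add: inj_on_def card_lowdeg)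

context short_sums
begin

text \<open>Counts pairs \<open>(P, F)\<close> with \<open>P\<close> dividing a monic \<open>F\<close> of degree \<open>N\<close>, weighted by \<open>degree P\<close>.\<close>

lemma sum_degree_div_norm_le:
  assumes N: "\<And>P. P \<in> S \<Longrightarrow> degree P \<le> N"
  shows "(\<Sum>P\<in>S. degree P / q ^ degree P) \<le> N"
proof -
  have ge: "CARD('a) ^ (N - degree P) \<le> card {F\<in>monic_polys N. P dvd F}" if P: "P \<in> S" for P
  proof -
    have "(\<lambda>F. P * F) ` monic_polys (N - degree P) \<subseteq> {F\<in>monic_polys N. P dvd F}"
    proof safe
      fix F :: "'a poly" assume F: "F \<in> monic_polys (N - degree P)"
      hence "F \<noteq> 0" by (auto simp: monic_polys_def)
      thus "P * F \<in> monic_polys N"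
        using F N[OF P] monic[OF P] nonzero_S[OF P] lead_coeff_mult[of P F]
        by (auto simp: monic_polys_def degree_mult_eq)
    qed auto
    hence "card ((\<lambda>F. P * F) ` monic_polys (N - degree P)) \<le> card {F\<in>monic_polys N. P dvd F}"
      by (intro card_mono) auto
    thus ?thesis
      using nonzero_S[OF P] by (subst (asm) card_image) (auto simp: inj_on_def card_monic_polys)
  qed
  have le: "(\<Sum>P\<in>{P\<in>S. P dvd F}. degree P) \<le> N" if F: "F \<in> monic_polys N" for F
  proof -
    have "\<Prod>{P\<in>S. P dvd F} dvd F" by (rule prod_dvdI) auto
    moreover have "F \<noteq> 0" using F by (auto simp: monic_polys_def)
    ultimately have "dg {P\<in>S. P dvd F} \<le> degree F"
      using dvd_imp_degree_le[of "\<Prod>{P\<in>S. P dvd F}" F] by (simp add: degree_prod_S)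
    thus ?thesis using F by (simp add: dg_def monic_polys_def)
  qed
  have "(\<Sum>P\<in>S. degree P * CARD('a) ^ (N - degree P))
      \<le> (\<Sum>P\<in>S. degree P * card {F\<in>monic_polys N. P dvd F})"
    using ge by (intro sum_mono mult_left_mono) auto
  also have "\<dots> = (\<Sum>P\<in>S. \<Sum>F\<in>monic_polys N. if P dvd F then degree P else 0)"
    by (simp add: sum.If_cases Int_def mult.commute)
  also have "\<dots> = (\<Sum>F\<in>monic_polys N. \<Sum>P\<in>{P\<in>S. P dvd F}. degree P)"
    using fin by (subst sum.swap) (simp add: sum.If_cases Int_def)
  also have "\<dots> \<le> card (monic_polys N :: 'a poly set) * N"
    using le by (metis (no_types, lifting) sum_bounded_above of_nat_id)
  finally have "(\<Sum>P\<in>S. degree P * CARD('a) ^ (N - degree P)) \<le> CARD('a) ^ N * N"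
    by (simp add: card_monic_polys)
  hence "real (\<Sum>P\<in>S. degree P * CARD('a) ^ (N - degree P)) \<le> real (CARD('a) ^ N * N)"
    using of_nat_le_iff by blast
  hence "(\<Sum>P\<in>S. degree P * q ^ (N - degree P)) \<le> q ^ N * N"
    by (simp add: q_eq)
  moreover have "(\<Sum>P\<in>S. degree P * q ^ (N - degree P)) = q ^ N * (\<Sum>P\<in>S. degree P / q ^ degree P)"
    unfolding sum_distrib_left using N by (intro sum.cong refl) (simp add: power_diff)
  ultimately show ?thesis by simp
qed

lemma card_low_degree_le:
  "T \<subseteq> S \<Longrightarrow> card {P\<in>T. degree P \<le> k} \<le> card {F :: 'a poly. degree F \<le> k}"
  by (intro card_mono finite_degree_le) auto

text \<open>Primes of degree at most \<open>k\<close> are bounded in number by a constant, and each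
  other prime takes more than \<open>k\<close> from \<open>dg T\<close>. A large constant
  \<open>k\<close> makes the second term a small multiple of \<open>dg T\<close>.\<close>

lemma card_le_dg:
  assumes T: "T \<subseteq> S" and k: "k > 0"
  shows "real (card T) \<le> card {F :: 'a poly. degree F \<le> k} + dg T / k"
proof -
  have "real (card T) = (\<Sum>P\<in>T. 1)" by simp
  also have "\<dots> \<le> (\<Sum>P\<in>T. (if degree P \<le> k then 1 else 0) + degree P / k)"
    using k by (intro sum_mono) (auto simp: field_simps)
  also have "\<dots> = card {P\<in>T. degree P \<le> k} + dg T / k"
    using finite_sub[OF T]
    by (simp add: sum.distrib sum.If_cases Int_def dg_def flip: sum_divide_distrib)
  also have "\<dots> \<le> card {F :: 'a poly. degree F \<le> k} + dg T / k"
    using card_low_degree_le[OF T] by simp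
  finally show ?thesis .
qed

text \<open>For degrees above \<open>k\<close>, inserting \<open>degree P / k > 1\<close> reduces to
  the sum weighted by \<open>degree P\<close>. Again \<open>N\<close> gets the small coefficient
  \<open>1 / k\<close>.\<close>

lemma sum_inverse_norm_le:
  assumes N: "\<And>P. P \<in> S \<Longrightarrow> degree P \<le> N" and k: "k > 0"
  shows "(\<Sum>P\<in>S. 1 / q ^ degree P) \<le> card {F :: 'a poly. degree F \<le> k} + N / k"
proof -
  have "(\<Sum>P\<in>S. 1 / q ^ degree P) \<le>
      (\<Sum>P\<in>S. (if degree P \<le> k then 1 else 0) + degree P / q ^ degree P / k)"
  proof (intro sum_mono)
    fix P :: "'a poly"
    have "1 / q ^ degree P \<le> 1" using one_le_power[OF q_ge_1, of "degree P"] by (simp add: field_simps)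
    moreover have "1 / q ^ degree P \<le> degree P / q ^ degree P / k" if "\<not> degree P \<le> k"
      using that k by (simp add: field_simps)
    ultimately show "1 / q ^ degree P \<le> (if degree P \<le> k then 1 else 0) + degree P / q ^ degree P / k"
      by (auto intro: add_increasing2)
  qed
  also have "\<dots> = card {P\<in>S. degree P \<le> k} + (\<Sum>P\<in>S. degree P / q ^ degree P) / k"
    using fin by (simp add: sum.distrib sum.If_cases Int_def sum_divide_distrib)
  also have "\<dots> \<le> card {F :: 'a poly. degree F \<le> k} + N / k"
    using card_low_degree_le[of S k] sum_degree_div_norm_le[OF N]
    by (intro add_mono divide_right_mono) auto
  finally show ?thesis .
qed

text \<open>The bound \<open>L\<close> and the Euler product are both at most the exponential of a
  linear function of \<open>h\<close> whose slope is of order \<open>1 / k\<close>. The parameter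
  \<open>d\<close> lets one exponential serve several values of \<open>c\<close>.\<close>

lemma pair_sum_le_exp:
  assumes N: "\<And>P. P \<in> S \<Longrightarrow> degree P \<le> 2 * h" and k: "k > 0"
    and c: "1 \<le> c" and d: "c \<le> d"
  shows "pair_sum c \<beta> \<le> (real h + 1)
    * exp (d\<^sup>2 * (card {F :: 'a poly. degree F \<le> k} + 2 * real h / k)) * wt (4 * c\<^sup>2) \<beta>"
proof -
  define n where "n = real (card {F :: 'a poly. degree F \<le> k})"
  define E where "E = exp (d\<^sup>2 * (n + 2 * real h / k))"
  have cd: "c\<^sup>2 \<le> d\<^sup>2" using c d by (intro power_mono) auto
  have L: "c ^ (2 * card T) \<le> E" if T: "T \<subseteq> S" "dg T < h" for T
  proof -
    have "real (card T) \<le> n + dg T / k" using card_le_dg[OF T(1) k] by (simp add: n_def)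
    also have "\<dots> \<le> n + 2 * real h / k" using T(2) k by (intro add_mono divide_right_mono) auto
    finally have *: "real (card T) \<le> n + 2 * real h / k" .
    have "c\<^sup>2 \<le> exp (c\<^sup>2)" using exp_ge_add_one_self[of "c\<^sup>2"] by linarith
    hence "c ^ (2 * card T) \<le> exp (c\<^sup>2) ^ card T"
      using c by (auto simp: power_mult intro!: power_mono)
    also have "\<dots> = exp (real (card T) * c\<^sup>2)" by (simp add: exp_of_nat_mult)
    also have "\<dots> \<le> E"
      using mult_mono[OF cd *] unfolding E_def by (simp add: mult.commute)
    finally show ?thesis .
  qed
  have M: "(\<Prod>P\<in>S. 1 + c\<^sup>2 / q ^ degree P) \<le> E"
  proof -
    have "(\<Prod>P\<in>S. 1 + c\<^sup>2 / q ^ degree P) \<le> (\<Prod>P\<in>S. exp (c\<^sup>2 / q ^ degree P))"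
      by (intro prod_mono conjI) (auto intro: add_nonneg_nonneg exp_ge_add_one_self)
    also have "\<dots> = exp (c\<^sup>2 * (\<Sum>P\<in>S. 1 / q ^ degree P))"
      using fin by (simp add: exp_sum sum_distrib_left)
    also have "\<dots> \<le> E"
      using sum_inverse_norm_le[OF N k] cd unfolding E_def n_def
      by (auto intro!: mult_mono sum_nonneg)
    finally show ?thesis .
  qed
  have "pair_sum c \<beta> \<le> (real h * E + (\<Prod>P\<in>S. 1 + c\<^sup>2 / q ^ degree P)) * wt (4 * c\<^sup>2) \<beta>"
    unfolding pair_sum_def pairs_def using c L by (rule pair_sum_le)
  also have "\<dots> \<le> (real h * E + E) * wt (4 * c\<^sup>2) \<beta>"
    using M by (intro mult_right_mono add_mono wt_nonneg) (auto simp: E_def)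
  finally show ?thesis by (simp add: E_def n_def distrib_right)
qed

text \<open>The two collapsed pairs cost \<open>2 * K + K\<^sup>2 \<le> 3 * K\<^sup>2\<close>, the
  triple sum another \<open>3 * K\<^sup>2\<close>, and the rotations 5; hence 45.\<close>

lemma quintuple_sum_le_exp:
  assumes N: "\<And>P. P \<in> S \<Longrightarrow> degree P \<le> 2 * h" and k: "k > 0"
  defines "K \<equiv> (real h + 1) * exp (64\<^sup>2 * (card {F :: 'a poly. degree F \<le> k} + 2 * real h / k))"
  shows "quintuple_sum \<le> 45 * K ^ 4 / q ^ (3 * h)"
proof -
  have "1 * 1 \<le> K" unfolding K_def by (intro mult_mono) auto
  hence K: "K \<ge> 1" by simp
  \<comment> \<open>Each collapse replaces \<open>c\<close> by \<open>4 * c\<^sup>2\<close>, which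
    leads from 1 through 4 and 64 to 16384. The bound is applied to the first three of these, all at
    most \<open>d = 64\<close>.\<close>
  note p = pair_sum_le_exp[OF N k, of _ 64, folded K_def]
  have p1: "pair_sum 1 \<beta> \<le> K * wt 4 \<beta>" for \<beta> using p[of 1 \<beta>] by simp
  have p4: "pair_sum 4 \<beta> \<le> K * wt 64 \<beta>" for \<beta> using p[of 4 \<beta>] by simp
  have p64: "pair_sum 64 \<beta> \<le> K * wt 16384 \<beta>" for \<beta> using p[of 64 \<beta>] by simp
  have t: "triple_sum 4 \<le> 3 * K * K / (q ^ h * q ^ h)"
    using K p4 p64 by (intro triple_sum_le[where d = 64 and e = 16384]) auto
  have "quintuple_sum \<le> 5 * (2 * K + K\<^sup>2) * triple_sum 4 / q ^ h"
    using K p1 by (intro quintuple_sum_le) auto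
  also have "\<dots> \<le> 5 * (3 * K\<^sup>2) * (3 * K * K / (q ^ h * q ^ h)) / q ^ h"
  proof -
    have "triple_sum 4 \<ge> 0"
      by (auto simp: triple_sum_def intro!: sum_nonneg mult_nonneg_nonneg wt_nonneg)
    moreover have "K \<le> K\<^sup>2" using K by (simp add: power2_eq_square)
    ultimately show ?thesis
      using t K by (intro divide_right_mono mult_mono) auto
  qed
  also have "\<dots> = 45 * K ^ 4 / q ^ (3 * h)"
    by (simp add: eval_nat_numeral power_add)
  finally show ?thesis .
qed

end

section \<open>The bound for the primorial and the choice of constants\<close>

lemma abs_m5_small_primorial_le:
  assumes "h \<ge> 1" "k > 0"
  shows "\<bar>m5 (small_primorial h :: 'a::{field, finite} poly) h\<bar> \<le>
    real (pnorm (small_primorial h :: 'a poly)) * real CARD('a) ^ (2 * h) *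
    (45 * ((real h + 1) * exp (64\<^sup>2 * (card {F :: 'a poly. degree F \<le> k} + 2 * real h / k))) ^ 4)"
proof -
  define S where "S = (small_irreducibles h :: 'a poly set)"
  define q where "q = real CARD('a)"
  obtain \<psi> :: "'a \<Rightarrow> complex" where \<psi>: "\<And>x y. \<psi> (x + y) = \<psi> x * \<psi> y" "\<psi> 0 = 1" "\<exists>x. \<psi> x \<noteq> 1"
    using exists_additive_character by blast
  \<comment> \<open>This polynomial has norm \<open>q\<close>, which is at most
    \<open>q^(2h)\<close> because \<open>h \<ge> 1\<close>. It makes \<open>S\<close> nonempty, as
    the locale demands.\<close>
  have "[:0, 1:] \<in> S"
    using assms(1) card_field_gt_1[where 'a = 'a] power_increasing[of 1 "2 * h" "CARD('a)"]
    by (auto simp: S_def small_irreducibles_def pnorm_def intro!: irreducible_linear_field_poly)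
  have Q: "small_primorial h = \<Prod>S" by (simp add: small_primorial_def S_def)
  from \<open>[:0, 1:] \<in> S\<close> have "S \<noteq> {}" by blast
  moreover have "finite S" unfolding S_def by (rule finite_small_irreducibles)
  moreover have "irreducible P" "lead_coeff P = 1" if "P \<in> S" for P
    using that by (simp_all add: S_def small_irreducibles_def)
  ultimately
  interpret short_sums_character S h q \<psi>
    by unfold_locales (use \<psi> in \<open>auto simp: q_def\<close>)
  have N: "degree P \<le> 2 * h" if "P \<in> S" for P
    using that nonzero_S[OF that] card_field_gt_1[where 'a = 'a]
    by (auto simp: S_def small_irreducibles_def pnorm_def)
  define K where "K = (real h + 1) * exp (64\<^sup>2 * (card {F :: 'a poly. degree F \<le> k} + 2 * real h / k))"
  have "\<bar>m5 (\<Prod>S) h\<bar> \<le> q ^ dg S * q ^ (5 * h) * quintuple_sum" by (rule abs_m5_le)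
  also have "\<dots> \<le> q ^ dg S * q ^ (5 * h) * (45 * K ^ 4 / q ^ (3 * h))"
    unfolding K_def using N assms(2) by (intro mult_left_mono quintuple_sum_le_exp) auto
  also have "\<dots> = q ^ dg S * q ^ (2 * h) * (45 * K ^ 4)"
  proof -
    have "5 * h = 3 * h + 2 * h" by simp
    thus ?thesis by (simp only: power_add) simp
  qed
  finally show ?thesis
    by (simp only: Q pnorm_prod flip: K_def q_def)
qed

theorem theorem1p4:
  fixes \<epsilon> :: real
  assumes "\<epsilon> > 0"
  shows "\<exists>C>0. \<forall>h::nat. h \<ge> 1 \<longrightarrow>
           (\<forall>Q :: 'a::{field, finite} poly. Q = small_primorial h \<longrightarrow>
              \<bar>m5 Q h\<bar> \<le> C * real (pnorm Q) * real CARD('a) powr ((2 + \<epsilon>) * real h))"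
proof -
  define q where "q = real CARD('a)"
  have q: "q > 1" using card_field_gt_1[where 'a = 'a] by (simp add: q_def)
  \<comment> \<open>One factor \<open>exp (\<eta> h)\<close> is allotted to
    \<open>(h + 1) ^ 4\<close> and one to the exponential; their product is
    \<open>q^(\<epsilon> h)\<close>.\<close>
  define \<eta> where "\<eta> = \<epsilon> * ln q / 2"
  have \<eta>: "\<eta> > 0" using assms q by (simp add: \<eta>_def)
  \<comment> \<open>Chosen so that the fourth power of the exponential grows at most like
    \<open>exp (\<eta> h)\<close>. It depends only on \<open>\<epsilon>\<close> and
    \<open>q\<close>, and so does \<open>C\<close>.\<close>
  define k where "k = nat \<lceil>4 * 64\<^sup>2 * 2 / \<eta>\<rceil>"
  have k_ge: "real k \<ge> 4 * 64\<^sup>2 * 2 / \<eta>" by (simp add: k_def real_nat_ceiling_ge)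
  moreover have "4 * 64\<^sup>2 * 2 / \<eta> > 0" using \<eta> by simp
  ultimately have k: "k > 0" using of_nat_0_less_iff[of k, where 'a = real] by linarith
  define n where "n = real (card {F :: 'a poly. degree F \<le> k})"
  define C where "C = 45 * (1 + 4 / \<eta>) ^ 4 * exp (4 * 64\<^sup>2 * n)"
  have "C > 0" using \<eta> by (auto simp: C_def intro!: mult_pos_pos zero_less_power add_pos_pos)
  moreover have "\<bar>m5 Q h\<bar> \<le> C * real (pnorm Q) * real CARD('a) powr ((2 + \<epsilon>) * real h)"
    if h: "h \<ge> 1" and Q: "Q = small_primorial h" for h and Q :: "'a poly"
  proof -
    \<comment> \<open>The product on the right is \<open>h + 1\<close> plus positive terms; the
      scale \<open>\<eta> / 4\<close> yields \<open>exp (\<eta> h)\<close> after taking the fourth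
      power.\<close>
    have "real h + 1 \<le> (1 + 4 / \<eta>) * (1 + \<eta> * h / 4)"
      using \<eta> by (simp add: field_simps)
    also have "\<dots> \<le> (1 + 4 / \<eta>) * exp (\<eta> * h / 4)"
      using \<eta> by (intro mult_left_mono exp_ge_add_one_self) auto
    finally have "(real h + 1) ^ 4 \<le> ((1 + 4 / \<eta>) * exp (\<eta> * h / 4)) ^ 4"
      by (intro power_mono) auto
    also have "\<dots> = (1 + 4 / \<eta>) ^ 4 * exp (\<eta> * h)"
      by (simp add: power_mult_distrib flip: exp_of_nat_mult)
    finally have 1: "(real h + 1) ^ 4 \<le> (1 + 4 / \<eta>) ^ 4 * exp (\<eta> * h)" .
    have "4 * 64\<^sup>2 * 2 / real k \<le> \<eta>"
      using k_ge k \<eta> by (simp add: field_simps)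
    hence "4 * 64\<^sup>2 * 2 / real k * h \<le> \<eta> * h" by (intro mult_right_mono) auto
    moreover have "exp (64\<^sup>2 * (n + 2 * real h / k)) ^ 4
        = exp (4 * 64\<^sup>2 * n) * exp (4 * 64\<^sup>2 * 2 / real k * h)"
      by (simp add: algebra_simps flip: exp_of_nat_mult exp_add)
    ultimately have 2: "exp (64\<^sup>2 * (n + 2 * real h / k)) ^ 4 \<le> exp (4 * 64\<^sup>2 * n) * exp (\<eta> * h)"
      by simp
    have "\<bar>m5 Q h\<bar> \<le> real (pnorm Q) * q ^ (2 * h) *
        (45 * ((real h + 1) ^ 4 * exp (64\<^sup>2 * (n + 2 * real h / k)) ^ 4))"
      using abs_m5_small_primorial_le[OF h k, where 'a = 'a]
      by (simp only: Q q_def n_def power_mult_distrib)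
    also have "\<dots> \<le> real (pnorm Q) * q ^ (2 * h) *
        (45 * (((1 + 4 / \<eta>) ^ 4 * exp (\<eta> * h)) * (exp (4 * 64\<^sup>2 * n) * exp (\<eta> * h))))"
      using 1 2 q \<eta> by (intro mult_left_mono mult_mono) auto
    also have "\<dots> = C * real (pnorm Q) * (q ^ (2 * h) * (exp (\<eta> * h) * exp (\<eta> * h)))"
      by (simp add: C_def mult_ac)
    also have "exp (\<eta> * h) * exp (\<eta> * h) = q powr (\<epsilon> * h)"
      using q by (simp add: powr_def \<eta>_def mult_ac flip: exp_add)
    also have "q ^ (2 * h) * q powr (\<epsilon> * h) = q powr ((2 + \<epsilon>) * real h)"
      using q by (simp add: powr_realpow[symmetric] distrib_right powr_add)
    finally show ?thesis by (simp add: q_def)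
  qed
  ultimately show ?thesis by blast
qed

end
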